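(* Let $L$ be a triassociative algebra over a field $\mathbb{F}$ and let $0\to R\to F\to L\to 0$ be a free presentation of $L$. Then $$\mathcal{H}^2(L,\mathbb{F})\cong\frac{F'\cap R}{F\lozenge R+R\lozenge F}.$$ In particular, if $L$ is finite-dimensional, then $M(L)\cong\mathcal{H}^2(L,\mathbb{F})$.
   Context: Fix a field $\mathbb{F}$. A triassociative algebra is an $\mathbb{F}$-vector space $L$ with three bilinear products $\vdash,\dashv,\perp:L\times L\to L$ satisfying, for all $x,y,z\in L$: $(x\vdash y)\vdash z=x\vdash(y\vdash z)$; $(x\dashv y)\dashv z=x\dashv(y\dashv z)$; $(x\dashv y)\vdash z=x\vdash(y\vdash z)$; $(x\dashv y)\dashv z=x\dashv(y\vdash z)$; $(x\vdash y)\dashv z=x\vdash(y\dashv z)$; $(x\perp y)\vdash z=x\vdash(y\vdash z)$; $(x\dashv y)\dashv z=x\dashv(y\perp z)$; $(x\vdash y)\perp z=x\vdash(y\perp z)$; $(x\perp y)\dashv z=x\perp(y\dashv z)$; $(x\dashv y)\perp z=x\perp(y\vdash z)$; $(x\perp y)\perp z=x\perp(y\perp z)$. Homomorphisms are linear maps preserving all three products; ideals and quotients are defined in the usual way. The center $Z(L)$ is the set of all $z\in L$ with $z*x=x*z=0$ for all $x\in L$ and $*\in\{\vdash,\dashv,\perp\}$. For subalgebras $S,T$ of $L$, $S\lozenge T=S\vdash T+S\dashv T+S\perp T$, where $S*T$ is the span of all $s*t$; and $L'=L\lozenge L$. A free presentation of $L$ is a short exact sequence $0\to R\to F\to L\to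 0$ of homomorphisms with $F$ a free triassociative algebra and $R$ an ideal of $F$ (the first map being inclusion). A defining pair for $L$ is a pair $(K,M)$ of triassociative algebras with $L\cong K/M$ and $M\subseteq Z(K)\cap K'$. It is a maximal defining pair if $\dim K$ is maximal among defining pairs for $L$; then $K$ is called a cover of $L$ and $M$ is called the multiplier of $L$, denoted $M(L)$ (it has zero products, so it is determined up to isomorphism by its dimension). Second cohomology: here $\mathbb{F}$ is regarded as a central $L$-module (trivial actions, zero products). For a vector space $A$ so regarded and a triassociative algebra $B$, $\mathcal{Z}^2(B,A)$ is the space of 2-cocycles: triples $(f_\vdash,f_\dashv,f_\perp)$ of bilinear maps $B\times B\to A$ such that for all $x,y,z\in B$: $f_\vdash(x\vdash y,z)=f_\vdash(x,y\vdash z)$; $f_\dashv(x\dashv y,z)=f_\dashv(x,y\dashv z)$; $f_\vdash(x\dashv y,z)=f_\vdash(x,y\vdash z)$; $f_\dashv(x\dashv y,z)=f_\dashv(x,y\vdash z)$; $f_\dashv(x\vdash y,z)=f_\vdash(x,y\dashv z)$; $f_\vdash(x\perp y,z)=f_\vdash(x,y\vdash z)$; $f_\dashv(x\dashv y,z)=f_\dashv(x,y\perp z)$; $f_\perp(x\vdash y,z)=f_\vdash(x,y\perp z)$; $f_\dashv(x\perp y,z)=f_\perp(x,y\dashv z)$; $f_\perp(x\dashv y,z)=f_\perp(x,y\vdash z)$; $f_\perp(x\perp y,z)=f_\perp(x,y\perp z)$. $\mathcal{B}^2(B,A)$ is the subspace of 2-coboundaries: triples with $f_*(x,y)=-\varepsilon(x*y)$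 for all $x,y\in B$ and $*\in\{\vdash,\dashv,\perp\}$, for some linear map $\varepsilon:B\to A$. $\mathcal{H}^2(B,A)=\mathcal{Z}^2(B,A)/\mathcal{B}^2(B,A)$. Isomorphisms in the claim are of $\mathbb{F}$-vector spaces.
   Formalization: The first isomorphism is stated only when (F'∩R)/(F◇R+R◇F) is finite-dimensional (proved when L is): in general H²(L,𝔽) is the dual of this quotient, so the claim fails e.g. for infinite-dimensional L with zero products. *)

theory Defs
  imports Complex_Main "HOL-Library.Function_Algebras" "HOL-Library.Product_Plus"
    "HOL-Library.Set_Algebras" "HOL-Library.Equipollence"
begin

section \<open>Vector spaces with explicit carriers\<close>

text \<open>
  A vector space is a subspace (the carrier) of some ambient vector space, with the addition of the
  ambient type.  The records themselves carry no axioms, so that they can also describe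
  quotient spaces, whose elements are cosets.  Cosets are added by the setwise addition
  of HOL-Library.Set_Algebras, which is why linear maps are only required to live on types
  of class plus.
\<close>

record ('f, 'v) vspace =
  carrier :: "'v set"
  scl :: "'f \<Rightarrow> 'v \<Rightarrow> 'v"

definition is_vspace :: "('f::field, 'v::ab_group_add, 'm) vspace_scheme \<Rightarrow> bool" where
  "is_vspace V \<longleftrightarrow> vector_space (scl V) \<and> module.subspace (scl V) (carrier V)"

definition subspace_of :: "('f::field, 'v::ab_group_add, 'm) vspace_scheme \<Rightarrow> 'v set \<Rightarrow> bool" where
  "subspace_of V W \<longleftrightarrow> W \<subseteq> carrier V \<and> module.subspace (scl V) W"

definition restr_space :: "('f, 'v, 'm) vspace_scheme \<Rightarrow> 'v set \<Rightarrow> ('f, 'v) vspace" where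
  "restr_space V W = \<lparr>carrier = W, scl = scl V\<rparr>"

definition linear_on ::
  "('f, 'v::plus, 'm) vspace_scheme \<Rightarrow> ('f, 'w::plus, 'n) vspace_scheme \<Rightarrow> ('v \<Rightarrow> 'w) \<Rightarrow> bool" where
  "linear_on V W f \<longleftrightarrow>
     f ` carrier V \<subseteq> carrier W \<and>
     (\<forall>x\<in>carrier V. \<forall>y\<in>carrier V. f (x + y) = f x + f y) \<and>
     (\<forall>c. \<forall>x\<in>carrier V. f (scl V c x) = scl W c (f x))"

definition bilinear_on ::
  "('f, 'v::plus, 'm) vspace_scheme \<Rightarrow> ('f, 'w::plus, 'n) vspace_scheme \<Rightarrow>
     ('v \<Rightarrow> 'v \<Rightarrow> 'w) \<Rightarrow> bool" where
  "bilinear_on V W f \<longleftrightarrow>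
     (\<forall>x\<in>carrier V. linear_on V W (\<lambda>y. f x y)) \<and> (\<forall>y\<in>carrier V. linear_on V W (\<lambda>x. f x y))"

definition vspace_iso ::
  "('f, 'v::plus, 'm) vspace_scheme \<Rightarrow> ('f, 'w::plus, 'n) vspace_scheme \<Rightarrow> bool"
  (infix \<open>\<cong>\<^sub>v\<close> 50) where
  "V \<cong>\<^sub>v W \<longleftrightarrow> (\<exists>\<phi>. linear_on V W \<phi> \<and> bij_betw \<phi> (carrier V) (carrier W))"

definition quot_carrier :: "'v::plus set \<Rightarrow> 'v set \<Rightarrow> 'v set set" where
  "quot_carrier V W = (\<lambda>v. v +o W) ` V"

text \<open>The summand \<open>W\<close> in the scalar action matters only for the scalar 0.\<close>

definition quot_scl :: "('f \<Rightarrow> 'v \<Rightarrow> 'v) \<Rightarrow> 'v::plus set \<Rightarrow> 'f \<Rightarrow> 'v set \<Rightarrow> 'v set" where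
  "quot_scl s W c C = (\<Union>x\<in>C. s c x +o W)"

definition quot_space :: "('f, 'v::plus, 'm) vspace_scheme \<Rightarrow> 'v set \<Rightarrow> ('f, 'v set) vspace" where
  "quot_space V W = \<lparr>carrier = quot_carrier (carrier V) W, scl = quot_scl (scl V) W\<rparr>"

definition coord_space :: "nat \<Rightarrow> ('f::field, nat \<Rightarrow> 'f) vspace" where
  "coord_space n = \<lparr>carrier = {v. \<forall>i\<ge>n. v i = 0}, scl = (\<lambda>c v i. c * v i)\<rparr>"

text \<open>Stated through coordinate spaces so that it also applies to quotient spaces.\<close>

definition finite_dimensional :: "('f::field, 'v::plus, 'm) vspace_scheme \<Rightarrow> bool" where
  "finite_dimensional V \<longleftrightarrow> (\<exists>n. V \<cong>\<^sub>v (coord_space n :: ('f, nat \<Rightarrow> 'f) vspace))"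

definition basis_of :: "('f::field, 'v::ab_group_add, 'm) vspace_scheme \<Rightarrow> 'v set \<Rightarrow> bool" where
  "basis_of V B \<longleftrightarrow>
     B \<subseteq> carrier V \<and> \<not> module.dependent (scl V) B \<and> module.span (scl V) B = carrier V"

text \<open>Comparison of dimensions as cardinals, hence meaningful for infinite-dimensional spaces too.\<close>

definition dim_le ::
  "('f::field, 'v::ab_group_add, 'm) vspace_scheme \<Rightarrow>
   ('f, 'w::ab_group_add, 'n) vspace_scheme \<Rightarrow> bool" where
  "dim_le V W \<longleftrightarrow> (\<exists>B C. basis_of V B \<and> basis_of W C \<and> B \<lesssim> C)"

definition ground_field :: "('f::field, 'f) vspace" where
  "ground_field = \<lparr>carrier = UNIV, scl = (*)\<rparr>"


section \<open>Triassociative algebras\<close>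

record ('f, 'v) trialg = "('f, 'v) vspace" +
  lprod :: "'v \<Rightarrow> 'v \<Rightarrow> 'v" (infixl \<open>\<turnstile>\<index>\<close> 75)
  rprod :: "'v \<Rightarrow> 'v \<Rightarrow> 'v" (infixl \<open>\<stileturn>\<index>\<close> 75)
  mprod :: "'v \<Rightarrow> 'v \<Rightarrow> 'v" (infixl \<open>\<bottom>\<index>\<close> 75)

locale triassociative =
  fixes A :: "('f::field, 'v::ab_group_add) trialg" (structure)
  assumes vspace: "is_vspace A"
    and bilinear_lprod: "bilinear_on A A (lprod A)"
    and bilinear_rprod: "bilinear_on A A (rprod A)"
    and bilinear_mprod: "bilinear_on A A (mprod A)"
    and axioms:
      "\<lbrakk>x \<in> carrier A; y \<in> carrier A; z \<in> carrier A\<rbrakk> \<Longrightarrow> (x \<turnstile> y) \<turnstile> z = x \<turnstile> (y \<turnstile> z)"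
      "\<lbrakk>x \<in> carrier A; y \<in> carrier A; z \<in> carrier A\<rbrakk> \<Longrightarrow> (x \<stileturn> y) \<stileturn> z = x \<stileturn> (y \<stileturn> z)"
      "\<lbrakk>x \<in> carrier A; y \<in> carrier A; z \<in> carrier A\<rbrakk> \<Longrightarrow> (x \<stileturn> y) \<turnstile> z = x \<turnstile> (y \<turnstile> z)"
      "\<lbrakk>x \<in> carrier A; y \<in> carrier A; z \<in> carrier A\<rbrakk> \<Longrightarrow> (x \<stileturn> y) \<stileturn> z = x \<stileturn> (y \<turnstile> z)"
      "\<lbrakk>x \<in> carrier A; y \<in> carrier A; z \<in> carrier A\<rbrakk> \<Longrightarrow> (x \<turnstile> y) \<stileturn> z = x \<turnstile> (y \<stileturn> z)"
      "\<lbrakk>x \<in> carrier A; y \<in> carrier A; z \<in> carrier A\<rbrakk> \<Longrightarrow> (x \<bottom> y) \<turnstile> z = x \<turnstile> (y \<turnstile> z)"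
      "\<lbrakk>x \<in> carrier A; y \<in> carrier A; z \<in> carrier A\<rbrakk> \<Longrightarrow> (x \<stileturn> y) \<stileturn> z = x \<stileturn> (y \<bottom> z)"
      "\<lbrakk>x \<in> carrier A; y \<in> carrier A; z \<in> carrier A\<rbrakk> \<Longrightarrow> (x \<turnstile> y) \<bottom> z = x \<turnstile> (y \<bottom> z)"
      "\<lbrakk>x \<in> carrier A; y \<in> carrier A; z \<in> carrier A\<rbrakk> \<Longrightarrow> (x \<bottom> y) \<stileturn> z = x \<bottom> (y \<stileturn> z)"
      "\<lbrakk>x \<in> carrier A; y \<in> carrier A; z \<in> carrier A\<rbrakk> \<Longrightarrow> (x \<stileturn> y) \<bottom> z = x \<bottom> (y \<turnstile> z)"
      "\<lbrakk>x \<in> carrier A; y \<in> carrier A; z \<in> carrier A\<rbrakk> \<Longrightarrow> (x \<bottom> y) \<bottom> z = x \<bottom> (y \<bottom> z)"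

definition products :: "('f, 'v) trialg \<Rightarrow> ('v \<Rightarrow> 'v \<Rightarrow> 'v) set" where
  "products A = {lprod A, rprod A, mprod A}"

definition tri_hom :: "('f, 'v::plus) trialg \<Rightarrow> ('f, 'w::plus) trialg \<Rightarrow> ('v \<Rightarrow> 'w) \<Rightarrow> bool" where
  "tri_hom A B h \<longleftrightarrow>
     linear_on A B h \<and>
     (\<forall>x\<in>carrier A. \<forall>y\<in>carrier A.
        h (lprod A x y) = lprod B (h x) (h y) \<and>
        h (rprod A x y) = rprod B (h x) (h y) \<and>
        h (mprod A x y) = mprod B (h x) (h y))"

definition tri_iso :: "('f, 'v::plus) trialg \<Rightarrow> ('f, 'w::plus) trialg \<Rightarrow> bool"
  (infix \<open>\<cong>\<^sub>t\<close> 50) where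
  "A \<cong>\<^sub>t B \<longleftrightarrow> (\<exists>h. tri_hom A B h \<and> bij_betw h (carrier A) (carrier B))"

definition tri_ideal :: "('f::field, 'v::ab_group_add) trialg \<Rightarrow> 'v set \<Rightarrow> bool" where
  "tri_ideal A I \<longleftrightarrow>
     subspace_of A I \<and> (\<forall>p\<in>products A. \<forall>a\<in>carrier A. \<forall>x\<in>I. p a x \<in> I \<and> p x a \<in> I)"

definition quot_prod :: "('v \<Rightarrow> 'v \<Rightarrow> 'v) \<Rightarrow> 'v::plus set \<Rightarrow> 'v set \<Rightarrow> 'v set \<Rightarrow> 'v set" where
  "quot_prod p I C D = (\<Union>x\<in>C. \<Union>y\<in>D. p x y +o I)"

definition quot_alg :: "('f, 'v::plus) trialg \<Rightarrow> 'v set \<Rightarrow> ('f, 'v set) trialg" where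
  "quot_alg A I =
     \<lparr>carrier = quot_carrier (carrier A) I, scl = quot_scl (scl A) I,
      lprod = quot_prod (lprod A) I, rprod = quot_prod (rprod A) I, mprod = quot_prod (mprod A) I\<rparr>"

definition center :: "('f, 'v::zero) trialg \<Rightarrow> 'v set" where
  "center A = {z \<in> carrier A. \<forall>p\<in>products A. \<forall>x\<in>carrier A. p z x = 0 \<and> p x z = 0}"

definition prod_span ::
  "('f::field, 'v::ab_group_add) trialg \<Rightarrow> ('v \<Rightarrow> 'v \<Rightarrow> 'v) \<Rightarrow> 'v set \<Rightarrow> 'v set \<Rightarrow> 'v set" where
  "prod_span A p S T = module.span (scl A) {p s t | s t. s \<in> S \<and> t \<in> T}"

definition lozenge :: "('f::field, 'v::ab_group_add) trialg \<Rightarrow> 'v set \<Rightarrow> 'v set \<Rightarrow> 'v set" where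
  "lozenge A S T = prod_span A (lprod A) S T + prod_span A (rprod A) S T + prod_span A (mprod A) S T"

definition derived :: "('f::field, 'v::ab_group_add) trialg \<Rightarrow> 'v set" where
  "derived A = lozenge A (carrier A) (carrier A)"


section \<open>Free presentations\<close>

text \<open>
  HOL formulas cannot quantify over types, so the universal property of free algebras and the
  maximality of defining pairs quantify over the algebras carried by subspaces of
  \<open>'x expr \<Rightarrow> 'f\<close>.  Here \<open>'x expr\<close> is the type of formal expressions over \<open>'x\<close> in three
  binary operations.
  An algebra generated by a family indexed by (a subset of) \<open>'x\<close> is spanned by the values of such
  expressions; selecting a basis among these values and mapping it to indicator functions embeds
  the algebra linearly into \<open>'x expr \<Rightarrow> 'f\<close>.  Every such algebra therefore has an isomorphic
  copy in this universe, and nothing is lost: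

  \<^item> For a map from \<open>X\<close> to an algebra \<open>B\<close>, one may replace \<open>B\<close> by the subalgebra generated by the
    image of \<open>X\<close>.  As the algebra \<open>F\<close> itself has a copy too, uniqueness forces \<open>X\<close> to generate
    \<open>F\<close>, so that the universal property holds for algebras over all types.

  \<^item> If \<open>(K, M)\<close> is a defining pair for \<open>L\<close>, then \<open>K = T + M\<close> for any set \<open>T\<close> of
    coset representatives of \<open>M\<close>; since \<open>M\<close> is central and contained in \<open>K'\<close>, the algebra \<open>K\<close>
    is generated by \<open>T\<close>, a set in bijection with \<open>L\<close>.
\<close>

datatype 'x expr = Gen 'x | Lp "'x expr" "'x expr" | Rp "'x expr" "'x expr" | Mp "'x expr" "'x expr"

definition free_on :: "('f::field, 'b::ab_group_add) trialg \<Rightarrow> 'b set \<Rightarrow> bool" where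
  "free_on F X \<longleftrightarrow>
     triassociative F \<and> X \<subseteq> carrier F \<and>
     (\<forall>(B :: ('f, 'b expr \<Rightarrow> 'f) trialg) g. triassociative B \<and> g ` X \<subseteq> carrier B \<longrightarrow>
        (\<exists>h. tri_hom F B h \<and> (\<forall>x\<in>X. h x = g x) \<and>
             (\<forall>h'. tri_hom F B h' \<and> (\<forall>x\<in>X. h' x = g x) \<longrightarrow> (\<forall>a\<in>carrier F. h' a = h a))))"

definition free_triassociative :: "('f::field, 'b::ab_group_add) trialg \<Rightarrow> bool" where
  "free_triassociative F \<longleftrightarrow> (\<exists>X. free_on F X)"

text \<open>\<open>free_presentation F R \<pi> L\<close>: the sequence \<open>0 \<rightarrow> R \<rightarrow> F \<rightarrow> L \<rightarrow> 0\<close> with maps the inclusion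
  and \<open>\<pi>\<close> is exact, and \<open>F\<close> is free.\<close>

definition free_presentation ::
  "('f::field, 'b::ab_group_add) trialg \<Rightarrow> 'b set \<Rightarrow> ('b \<Rightarrow> 'l) \<Rightarrow>
   ('f, 'l::ab_group_add) trialg \<Rightarrow> bool" where
  "free_presentation F R \<pi> L \<longleftrightarrow>
     free_triassociative F \<and> tri_ideal F R \<and> tri_hom F L \<pi> \<and>
     \<pi> ` carrier F = carrier L \<and> R = {x \<in> carrier F. \<pi> x = 0}"

text \<open>
  The space \<open>(F' \<inter> R) / (F \<lozenge> R + R \<lozenge> F)\<close>.  The second cohomology of \<open>L\<close> with coefficients in the
  ground field is the dual of this space; the two are isomorphic exactly when it is
  finite-dimensional, for instance when \<open>L\<close> is.  For an infinite-dimensional \<open>L\<close> with zero products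
  and \<open>F\<close> free on a basis of \<open>L\<close>, it is three copies of \<open>L \<otimes> L\<close>, whereas the cohomology
  consists of all triples of bilinear forms on \<open>L\<close>, a space of strictly larger dimension.
\<close>

definition hopf_quotient :: "('f::field, 'b::ab_group_add) trialg \<Rightarrow> 'b set \<Rightarrow> ('f, 'b set) vspace" where
  "hopf_quotient F R =
     quot_space (restr_space F (derived F \<inter> R)) (lozenge F (carrier F) R + lozenge F R (carrier F))"


section \<open>Defining pairs and multipliers\<close>

definition defining_pair ::
  "('f::field, 'l::ab_group_add) trialg \<Rightarrow> ('f, 'k::ab_group_add) trialg \<Rightarrow> 'k set \<Rightarrow> bool" where
  "defining_pair L K M \<longleftrightarrow>
     triassociative K \<and> tri_ideal K M \<and> M \<subseteq> center K \<inter> derived K \<and> L \<cong>\<^sub>t quot_alg K M"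

definition maximal_defining_pair ::
  "('f::field, 'l::ab_group_add) trialg \<Rightarrow> ('f, 'k::ab_group_add) trialg \<Rightarrow> 'k set \<Rightarrow> bool" where
  "maximal_defining_pair L K M \<longleftrightarrow>
     defining_pair L K M \<and>
     (\<forall>(K2 :: ('f, 'l expr \<Rightarrow> 'f) trialg) M2. defining_pair L K2 M2 \<longrightarrow> dim_le K2 K)"

text \<open>The multiplier has zero products, so only its vector space structure is recorded.\<close>

definition is_multiplier ::
  "('f::field, 'l::ab_group_add) trialg \<Rightarrow> ('f, 'k::ab_group_add) vspace \<Rightarrow> bool" where
  "is_multiplier L N \<longleftrightarrow> (\<exists>K M. maximal_defining_pair L K M \<and> N = restr_space K M)"


section \<open>Second cohomology with central coefficients\<close>

text \<open>
  Bilinear maps on \<open>B\<close> are represented by functions vanishing outside the carrier of \<open>B\<close>, so that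
  each one has exactly one representative.  Triples are ordered as \<open>(f\<^sub>\<turnstile>, f\<^sub>\<stileturn>, f\<^sub>\<bottom>)\<close>.
\<close>

type_synonym ('b, 'a) cochain = "('b \<Rightarrow> 'b \<Rightarrow> 'a) \<times> ('b \<Rightarrow> 'b \<Rightarrow> 'a) \<times> ('b \<Rightarrow> 'b \<Rightarrow> 'a)"

definition bilinear_maps ::
  "('f, 'b::plus, 'm) vspace_scheme \<Rightarrow> ('f, 'a::{plus,zero}, 'n) vspace_scheme \<Rightarrow>
     ('b \<Rightarrow> 'b \<Rightarrow> 'a) set" where
  "bilinear_maps B A =
     {f. bilinear_on B A f \<and> (\<forall>x y. x \<notin> carrier B \<or> y \<notin> carrier B \<longrightarrow> f x y = 0)}"

definition cocycles ::
  "('f::field, 'b::ab_group_add) trialg \<Rightarrow> ('f, 'a::ab_group_add) vspace \<Rightarrow> ('b, 'a) cochain set" where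
  "cocycles B A =
     {(fl, fr, fm). fl \<in> bilinear_maps B A \<and> fr \<in> bilinear_maps B A \<and> fm \<in> bilinear_maps B A \<and>
        (\<forall>x\<in>carrier B. \<forall>y\<in>carrier B. \<forall>z\<in>carrier B.
           fl (x \<turnstile>\<^bsub>B\<^esub> y) z = fl x (y \<turnstile>\<^bsub>B\<^esub> z) \<and>
           fr (x \<stileturn>\<^bsub>B\<^esub> y) z = fr x (y \<stileturn>\<^bsub>B\<^esub> z) \<and>
           fl (x \<stileturn>\<^bsub>B\<^esub> y) z = fl x (y \<turnstile>\<^bsub>B\<^esub> z) \<and>
           fr (x \<stileturn>\<^bsub>B\<^esub> y) z = fr x (y \<turnstile>\<^bsub>B\<^esub> z) \<and>
           fr (x \<turnstile>\<^bsub>B\<^esub> y) z = fl x (y \<stileturn>\<^bsub>B\<^esub> z) \<and>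
           fl (x \<bottom>\<^bsub>B\<^esub> y) z = fl x (y \<turnstile>\<^bsub>B\<^esub> z) \<and>
           fr (x \<stileturn>\<^bsub>B\<^esub> y) z = fr x (y \<bottom>\<^bsub>B\<^esub> z) \<and>
           fm (x \<turnstile>\<^bsub>B\<^esub> y) z = fl x (y \<bottom>\<^bsub>B\<^esub> z) \<and>
           fr (x \<bottom>\<^bsub>B\<^esub> y) z = fm x (y \<stileturn>\<^bsub>B\<^esub> z) \<and>
           fm (x \<stileturn>\<^bsub>B\<^esub> y) z = fm x (y \<turnstile>\<^bsub>B\<^esub> z) \<and>
           fm (x \<bottom>\<^bsub>B\<^esub> y) z = fm x (y \<bottom>\<^bsub>B\<^esub> z))}"

definition coboundary ::
  "('f, 'b) trialg \<Rightarrow> ('b \<Rightarrow> 'a::ab_group_add) \<Rightarrow> ('b, 'a) cochain" where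
  "coboundary B \<epsilon> =
     (let d = (\<lambda>p x y. if x \<in> carrier B \<and> y \<in> carrier B then - \<epsilon> (p x y) else 0)
      in (d (lprod B), d (rprod B), d (mprod B)))"

definition coboundaries ::
  "('f::field, 'b::ab_group_add) trialg \<Rightarrow> ('f, 'a::ab_group_add) vspace \<Rightarrow> ('b, 'a) cochain set" where
  "coboundaries B A = {coboundary B \<epsilon> | \<epsilon>. linear_on B A \<epsilon>}"

definition cochain_scl :: "('f \<Rightarrow> 'a \<Rightarrow> 'a) \<Rightarrow> 'f \<Rightarrow> ('b, 'a) cochain \<Rightarrow> ('b, 'a) cochain" where
  "cochain_scl s c = (\<lambda>(fl, fr, fm).
     (\<lambda>x y. s c (fl x y), \<lambda>x y. s c (fr x y), \<lambda>x y. s c (fm x y)))"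

definition cohomology2 ::
  "('f::field, 'b::ab_group_add) trialg \<Rightarrow> ('f, 'a::ab_group_add) vspace \<Rightarrow>
     ('f, ('b, 'a) cochain set) vspace" where
  "cohomology2 B A =
     quot_space \<lparr>carrier = cocycles B A, scl = cochain_scl (scl A)\<rparr> (coboundaries B A)"

end

theory Submission
  imports Defs
begin

text \<open>
  Write \<open>S = F \<lozenge> R + R \<lozenge> F\<close>. A 2-cocycle \<open>f\<close> on \<open>L\<close> defines a central extension of \<open>L\<close> by
  the ground field, and lifting \<open>\<pi>\<close> to it produces a linear functional \<open>\<theta>\<close> on \<open>F\<close> with
  \<open>\<theta> (x * y) = f\<^sub>* (\<pi> x) (\<pi> y)\<close>. The functional vanishes on \<open>S\<close>, its restriction to \<open>F'\<close> is
  determined by \<open>f\<close>, and \<open>f\<close> is a coboundary iff \<open>\<theta>\<close> vanishes on \<open>F' \<inter> R\<close>; conversely every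
  functional vanishing on \<open>S\<close> arises in this way. So the cohomology is the dual of
  \<open>(F' \<inter> R) / S\<close>. For a defining pair \<open>(K, M)\<close>, a lift \<open>F \<rightarrow> K\<close> of \<open>\<pi>\<close> kills \<open>S\<close> and maps
  \<open>F' \<inter> R\<close> onto \<open>M\<close>, which bounds \<open>dim M\<close>. The bound is attained by \<open>F / T\<close>, where
  \<open>T / S\<close> is a complement of \<open>(F' \<inter> R) / S\<close> in \<open>R / S\<close>.
\<close>

section \<open>Linear algebra on carriers\<close>

text \<open>A vector space and its dual are isomorphic only in finite dimension, and not
  canonically. So no direct map between the cohomology and \<open>hopf_quotient\<close> is built:
  cohomology, quotient and multiplier are each identified with the same
  \<open>coord_space n\<close>. The link is one linear map \<open>\<phi>\<close> from F to
  \<open>coord_space n\<close> whose restriction to \<open>F' \<inter> R\<close> is onto with kernel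
  S. For finite-dimensional L such an n exists because a product in F depends modulo S only on the
  images of its factors in L, so that finitely many products of lifted basis vectors span
  \<open>F'\<close> modulo S. The obstacle is that \<open>free_on\<close> tests freeness only on
  algebras with elements of type \<open>'b expr \<Rightarrow> 'f\<close>. Each target of a lift (an
  extension, K, L itself) must come with an injective linear map into that type;
  \<open>expr_embedding\<close> provides the room. Maximality is tested in the type
  \<open>'l expr \<Rightarrow> 'f\<close>, so the cover is built as an image inside it, not as a
  coset algebra. Covers over any other type are compared with it by dimension alone.\<close>

lemma is_vspaceD:
  assumes "is_vspace V"
  shows "vector_space (scl V)" "module (scl V)" "module.subspace (scl V) (carrier V)"
    "0 \<in> carrier V"
    "x \<in> carrier V \<Longrightarrow> y \<in> carrier V \<Longrightarrow> x + y \<in> carrier V"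
    "x \<in> carrier V \<Longrightarrow> y \<in> carrier V \<Longrightarrow> x - y \<in> carrier V"
    "x \<in> carrier V \<Longrightarrow> - x \<in> carrier V"
    "x \<in> carrier V \<Longrightarrow> scl V c x \<in> carrier V"
proof -
  interpret vector_space "scl V" using assms by (simp add: is_vspace_def)
  have "subspace (carrier V)" using assms by (simp add: is_vspace_def)
  then show "vector_space (scl V)" "module (scl V)" "subspace (carrier V)" "0 \<in> carrier V"
    "x \<in> carrier V \<Longrightarrow> y \<in> carrier V \<Longrightarrow> x + y \<in> carrier V"
    "x \<in> carrier V \<Longrightarrow> y \<in> carrier V \<Longrightarrow> x - y \<in> carrier V"
    "x \<in> carrier V \<Longrightarrow> - x \<in> carrier V"
    "x \<in> carrier V \<Longrightarrow> scl V c x \<in> carrier V"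
    using vector_space_axioms module_axioms
    by (auto intro: subspace_0 subspace_add subspace_diff subspace_neg subspace_scale)
qed

lemma restr_space_simps [simp]:
  "carrier (restr_space V W) = W" "scl (restr_space V W) = scl V"
  by (simp_all add: restr_space_def)

lemma ground_field_simps [simp]: "carrier ground_field = UNIV" "scl ground_field = (*)"
  by (simp_all add: ground_field_def)

lemma subspace_ofD:
  assumes "is_vspace V" "subspace_of V U"
  shows "is_vspace (restr_space V U)" "U \<subseteq> carrier V" "module.subspace (scl V) U" "0 \<in> U"
    "x \<in> U \<Longrightarrow> y \<in> U \<Longrightarrow> x + y \<in> U"
    "x \<in> U \<Longrightarrow> y \<in> U \<Longrightarrow> x - y \<in> U"
    "x \<in> U \<Longrightarrow> - x \<in> U"
    "x \<in> U \<Longrightarrow> scl V c x \<in> U"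
proof -
  have r: "is_vspace (restr_space V U)" using assms by (simp add: is_vspace_def subspace_of_def)
  show "is_vspace (restr_space V U)" "U \<subseteq> carrier V" "module.subspace (scl V) U" "0 \<in> U"
    "x \<in> U \<Longrightarrow> y \<in> U \<Longrightarrow> x + y \<in> U"
    "x \<in> U \<Longrightarrow> y \<in> U \<Longrightarrow> x - y \<in> U"
    "x \<in> U \<Longrightarrow> - x \<in> U"
    "x \<in> U \<Longrightarrow> scl V c x \<in> U"
    using r is_vspaceD[OF r] assms by (auto simp: subspace_of_def)
qed

lemma subspace_of_span:
  assumes "is_vspace V" "A \<subseteq> carrier V"
  shows "subspace_of V (module.span (scl V) A)"
proof -
  interpret vector_space "scl V" using assms by (simp add: is_vspace_def)
  show ?thesis unfolding subspace_of_def
    using assms is_vspaceD(3)[OF assms(1)] by (simp add: span_minimal)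
qed

lemma subspace_of_inter:
  assumes "is_vspace V" "subspace_of V A" "subspace_of V B"
  shows "subspace_of V (A \<inter> B)"
proof -
  interpret vector_space "scl V" using assms by (simp add: is_vspace_def)
  show ?thesis using assms by (auto simp: subspace_of_def intro: subspace_inter)
qed

section \<open>Linear maps between carriers\<close>

lemma linear_onD:
  assumes "linear_on V W f"
  shows "x \<in> carrier V \<Longrightarrow> f x \<in> carrier W"
    "x \<in> carrier V \<Longrightarrow> y \<in> carrier V \<Longrightarrow> f (x + y) = f x + f y"
    "x \<in> carrier V \<Longrightarrow> f (scl V c x) = scl W c (f x)"
  using assms by (auto simp: linear_on_def)

lemma linear_onI:
  assumes "\<And>x. x \<in> carrier V \<Longrightarrow> f x \<in> carrier W"
    "\<And>x y. x \<in> carrier V \<Longrightarrow> y \<in> carrier V \<Longrightarrow> f (x + y) = f x + f y"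
    "\<And>c x. x \<in> carrier V \<Longrightarrow> f (scl V c x) = scl W c (f x)"
  shows "linear_on V W f"
  using assms by (auto simp: linear_on_def)

lemma linear_on_comp:
  assumes "linear_on V W f" "linear_on W Z g"
  shows "linear_on V Z (\<lambda>x. g (f x))"
  by (rule linear_onI) (simp_all add: linear_onD[OF assms(1)] linear_onD[OF assms(2)])

lemma linear_on_zero:
  fixes f :: "'v::ab_group_add \<Rightarrow> 'w::ab_group_add"
  assumes "is_vspace V" "linear_on V W f"
  shows "f 0 = 0"
  using linear_onD(2)[OF assms(2), of 0 0] is_vspaceD(4)[OF assms(1)] by simp

lemma linear_on_diff:
  fixes f :: "'v::ab_group_add \<Rightarrow> 'w::ab_group_add"
  assumes "is_vspace V" "linear_on V W f" "x \<in> carrier V" "y \<in> carrier V"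
  shows "f (x - y) = f x - f y"
  using linear_onD(2)[OF assms(2), of "x - y" y] is_vspaceD(6)[OF assms(1)] assms(3,4)
  by (simp add: algebra_simps)

lemma inj_on_linear_iff:
  fixes f :: "'v::ab_group_add \<Rightarrow> 'w::ab_group_add"
  assumes "is_vspace V" "linear_on V W f"
  shows "inj_on f (carrier V) \<longleftrightarrow> (\<forall>x\<in>carrier V. f x = 0 \<longrightarrow> x = 0)"
proof
  assume "inj_on f (carrier V)"
  then show "\<forall>x\<in>carrier V. f x = 0 \<longrightarrow> x = 0"
    using linear_on_zero[OF assms] is_vspaceD(4)[OF assms(1)] by (metis inj_onD)
next
  assume r: "\<forall>x\<in>carrier V. f x = 0 \<longrightarrow> x = 0"
  show "inj_on f (carrier V)"
  proof (rule inj_onI)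
    fix x y assume *: "x \<in> carrier V" "y \<in> carrier V" "f x = f y"
    then have "f (x - y) = 0" by (simp add: linear_on_diff[OF assms])
    then show "x = y" using r * is_vspaceD(6)[OF assms(1)] by (metis eq_iff_diff_eq_0)
  qed
qed

section \<open>Bases, sections and extension of linear maps\<close>

lemma basis_of_extend:
  assumes "is_vspace V" "B0 \<subseteq> carrier V" "\<not> module.dependent (scl V) B0"
  obtains B where "B0 \<subseteq> B" "basis_of V B"
proof -
  interpret vector_space "scl V" using assms by (simp add: is_vspace_def)
  obtain B where "B0 \<subseteq> B" "B \<subseteq> carrier V" "independent B" "carrier V \<subseteq> span B"
    using maximal_independent_subset_extend[OF assms(2,3)] by blast
  then show ?thesis using that is_vspaceD(3)[OF assms(1)]
    by (simp add: basis_of_def span_subspace)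
qed

lemma basis_of_exists:
  assumes "is_vspace V"
  obtains B where "basis_of V B"
proof -
  interpret vector_space "scl V" using assms by (simp add: is_vspace_def)
  show ?thesis using basis_of_extend[OF assms _ independent_empty] that by blast
qed

lemma basis_of_subspace_extend:
  assumes "is_vspace V" "subspace_of V U" "basis_of (restr_space V U) B0"
  obtains B where "B0 \<subseteq> B" "basis_of V B"
  using basis_of_extend[OF assms(1), of B0] assms(2,3) by (auto simp: basis_of_def subspace_of_def)

lemma linear_on_basis_extend:
  assumes "is_vspace V" "is_vspace W" "basis_of V B" "f ` B \<subseteq> carrier W"
  obtains g where "Vector_Spaces.linear (scl V) (scl W) g" "linear_on V W g" "\<forall>x\<in>B. g x = f x"
proof -
  interpret vector_space_pair "scl V" "scl W"
    using assms by (simp add: is_vspace_def vector_space_pair_def)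
  obtain g where g: "Vector_Spaces.linear (scl V) (scl W) g" "\<forall>x\<in>B. g x = f x"
    using linear_independent_extend assms(3) unfolding basis_of_def by blast
  have "g ` carrier V = vs2.span (f ` B)"
    using linear_span_image[OF g(1), of B] assms(3) g(2) by (auto simp: basis_of_def cong: image_cong)
  then have "g ` carrier V \<subseteq> carrier W"
    using assms(2,4) by (auto simp: is_vspace_def vs2.span_minimal dest: vs2.span_minimal)
  then have "linear_on V W g"
    by (auto simp: linear_on_def linear_add[OF g(1)] linear_scale[OF g(1)])
  then show ?thesis using that g by blast
qed

lemma linear_on_eq_on_span:
  fixes f g :: "'v::ab_group_add \<Rightarrow> 'w::ab_group_add"
  assumes "is_vspace V" "linear_on V W f" "linear_on V W g" "B \<subseteq> carrier V"
    "\<And>x. x \<in> B \<Longrightarrow> f x = g x" "is_vspace W" "x \<in> module.span (scl V) B"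
  shows "f x = g x"
proof -
  interpret vector_space "scl V" using assms by (simp add: is_vspace_def)
  have "x \<in> carrier V \<and> f x = g x" using assms(7)
  proof (induction rule: span_induct_alt)
    case base show ?case
      using linear_on_zero[OF assms(1,2)] linear_on_zero[OF assms(1,3)] is_vspaceD(4)[OF assms(1)]
      by simp
  next
    case (step c x y)
    then have "x \<in> carrier V" "f x = g x" using assms(4,5) by auto
    then show ?case using step(2) is_vspaceD(5,8)[OF assms(1)]
      by (simp add: linear_onD(2,3)[OF assms(2)] linear_onD(2,3)[OF assms(3)])
  qed
  then show ?thesis by simp
qed

text \<open>\<open>linear_on\<close> says nothing outside the carrier, whereas the library's linear
  maps live on the whole type. Prescribing the values of f on a basis of the carrier yields a total
  linear map with the same restriction, to which the library applies.\<close>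

lemma linear_on_ambient:
  fixes f :: "'v::ab_group_add \<Rightarrow> 'w::ab_group_add"
  assumes "is_vspace V" "is_vspace W" "linear_on V W f"
  obtains g where "Vector_Spaces.linear (scl V) (scl W) g" "linear_on V W g"
    "\<And>x. x \<in> carrier V \<Longrightarrow> g x = f x"
proof -
  obtain B where B: "basis_of V B" using basis_of_exists assms(1) by blast
  then have Bc: "B \<subseteq> carrier V" by (simp add: basis_of_def)
  then have "f ` B \<subseteq> carrier W" using linear_onD(1)[OF assms(3)] by auto
  then obtain g where g: "Vector_Spaces.linear (scl V) (scl W) g" "linear_on V W g" "\<forall>x\<in>B. g x = f x"
    using linear_on_basis_extend[OF assms(1,2) B] by blast
  have "g x = f x" if "x \<in> carrier V" for x
    using linear_on_eq_on_span[OF assms(1) g(2) assms(3) Bc] g(3) B that assms(2)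
    by (simp add: basis_of_def)
  then show ?thesis using that g by blast
qed

lemma linear_on_span_image:
  fixes f :: "'v::ab_group_add \<Rightarrow> 'w::ab_group_add"
  assumes "is_vspace V" "is_vspace W" "linear_on V W f" "A \<subseteq> carrier V"
  shows "f ` module.span (scl V) A = module.span (scl W) (f ` A)"
proof -
  interpret vector_space_pair "scl V" "scl W"
    using assms by (simp add: is_vspace_def vector_space_pair_def)
  obtain g where g: "Vector_Spaces.linear (scl V) (scl W) g" "\<And>x. x \<in> carrier V \<Longrightarrow> g x = f x"
    using linear_on_ambient[OF assms(1-3)] by blast
  have "vs1.span A \<subseteq> carrier V" using assms(1,4) by (simp add: is_vspace_def vs1.span_minimal)
  then have "f ` vs1.span A = g ` vs1.span A" "f ` A = g ` A"
    using g(2) assms(4) by (auto cong: image_cong simp: subset_iff)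
  then show ?thesis using linear_span_image[OF g(1)] by simp
qed

lemma linear_on_image_subspace:
  fixes f :: "'v::ab_group_add \<Rightarrow> 'w::ab_group_add"
  assumes "is_vspace V" "is_vspace W" "linear_on V W f"
  shows "subspace_of W (f ` carrier V)"
proof -
  have "module.span (scl V) (carrier V) = carrier V"
    using is_vspaceD(2,3)[OF assms(1)] by (simp add: module.span_eq_iff)
  then have "f ` carrier V = module.span (scl W) (f ` carrier V)"
    using linear_on_span_image[OF assms, of "carrier V"] by simp
  moreover have "f ` carrier V \<subseteq> carrier W" using assms(3) by (simp add: linear_on_def)
  ultimately show ?thesis using subspace_of_span[OF assms(2), of "f ` carrier V"] by simp
qed

lemma linear_on_kernel_subspace:
  fixes f :: "'v::ab_group_add \<Rightarrow> 'w::ab_group_add"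
  assumes "is_vspace V" "is_vspace W" "linear_on V W f"
  shows "subspace_of V {x \<in> carrier V. f x = 0}"
proof -
  interpret W: vector_space "scl W" using assms(2) by (simp add: is_vspace_def)
  show ?thesis
    unfolding subspace_of_def module.subspace_def[OF is_vspaceD(2)[OF assms(1)]]
    using is_vspaceD(4,5,8)[OF assms(1)] linear_on_zero[OF assms(1,3)]
    by (auto simp: linear_onD(2,3)[OF assms(3)])
qed

text \<open>Supplies linear preimages, so that elements of L can later be represented in F, in K or
  in an extension in a way compatible with bilinearity.\<close>

lemma linear_on_section:
  fixes f :: "'v::ab_group_add \<Rightarrow> 'w::ab_group_add"
  assumes "is_vspace V" "is_vspace W" "linear_on V W f"
  obtains s where "linear_on (restr_space W (f ` carrier V)) V s"
    "\<And>y. y \<in> f ` carrier V \<Longrightarrow> f (s y) = y"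
proof -
  interpret vector_space_pair "scl V" "scl W"
    using assms by (simp add: is_vspace_def vector_space_pair_def)
  obtain g where g: "Vector_Spaces.linear (scl V) (scl W) g" "\<And>x. x \<in> carrier V \<Longrightarrow> g x = f x"
    using linear_on_ambient[OF assms] by blast
  obtain s where s: "s ` UNIV \<subseteq> carrier V" "Vector_Spaces.linear (scl W) (scl V) s"
    "\<forall>v\<in>g ` carrier V. g (s v) = v"
    using linear_exists_right_inverse_on[OF g(1) is_vspaceD(3)[OF assms(1)]] by blast
  interpret s: Vector_Spaces.linear "scl W" "scl V" s by (rule s(2))
  have "linear_on (restr_space W (f ` carrier V)) V s"
    using s(1) by (auto simp: linear_on_def s.add s.scale)
  moreover have "f (s y) = y" if "y \<in> f ` carrier V" for y
  proof -
    have "g (s y) = y" using s(3) g(2) that by fastforce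
    moreover have "s y \<in> carrier V" using s(1) by blast
    ultimately show ?thesis using g(2) by simp
  qed
  ultimately show ?thesis by (rule that)
qed

lemma linear_on_section_onto:
  fixes f :: "'v::ab_group_add \<Rightarrow> 'w::ab_group_add"
  assumes "is_vspace V" "is_vspace W" "linear_on V W f" "f ` carrier V = carrier W"
  obtains s where "linear_on W V s" "\<And>y. y \<in> carrier W \<Longrightarrow> f (s y) = y"
proof -
  obtain s where s: "linear_on (restr_space W (f ` carrier V)) V s"
    "\<And>y. y \<in> f ` carrier V \<Longrightarrow> f (s y) = y"
    using linear_on_section[OF assms(1-3)] by blast
  show ?thesis
  proof (rule that[of s])
    show "linear_on W V s" using s(1) unfolding linear_on_def by (simp add: assms(4))
    show "f (s y) = y" if "y \<in> carrier W" for y using s(2) that by (simp add: assms(4))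
  qed
qed

lemma linear_on_extend:
  fixes f :: "'v::ab_group_add \<Rightarrow> 'w::ab_group_add"
  assumes "is_vspace V" "is_vspace W" "subspace_of V U" "linear_on (restr_space V U) W f"
  obtains g where "linear_on V W g" "\<And>x. x \<in> U \<Longrightarrow> g x = f x"
proof -
  note U = subspace_ofD[OF assms(1,3)]
  obtain B0 where B0: "basis_of (restr_space V U) B0" using basis_of_exists U(1) by blast
  obtain B where B: "B0 \<subseteq> B" "basis_of V B"
    using basis_of_subspace_extend[OF assms(1,3) B0] by blast
  have B0U: "B0 \<subseteq> U" using B0 by (simp add: basis_of_def)
  define h where "h x = (if x \<in> B0 then f x else 0)" for x
  have "h ` B \<subseteq> carrier W"
    using B0U linear_onD(1)[OF assms(4)] is_vspaceD(4)[OF assms(2)] by (auto simp: h_def)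
  then obtain g where g: "linear_on V W g" "\<forall>x\<in>B. g x = h x"
    using linear_on_basis_extend[OF assms(1,2) B(2)] by blast
  have gU: "linear_on (restr_space V U) W g" using g(1) U(2) by (auto simp: linear_on_def subset_iff)
  have "g x = f x" if "x \<in> U" for x
    by (rule linear_on_eq_on_span[OF U(1) gU assms(4) _ _ assms(2), of B0])
      (use that B0 B0U g(2) B(1) in \<open>auto simp: basis_of_def h_def\<close>)
  then show ?thesis using that g by blast
qed

text \<open>Since f kills the kernel of p, it is constant on the fibres of p. So f composed with a
  section of p is the required map on the image of p, and it extends linearly to all of W.\<close>

lemma linear_on_factor:
  fixes p :: "'v::ab_group_add \<Rightarrow> 'w::ab_group_add" and f :: "'v \<Rightarrow> 'z::ab_group_add"
  assumes "is_vspace V" "is_vspace W" "is_vspace Z" "linear_on V W p" "linear_on V Z f"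
    and ker: "\<And>x. x \<in> carrier V \<Longrightarrow> p x = 0 \<Longrightarrow> f x = 0"
  obtains g where "linear_on W Z g" "\<And>x. x \<in> carrier V \<Longrightarrow> g (p x) = f x"
proof -
  obtain s where s: "linear_on (restr_space W (p ` carrier V)) V s"
    "\<And>y. y \<in> p ` carrier V \<Longrightarrow> p (s y) = y"
    using linear_on_section[OF assms(1,2,4)] by blast
  obtain g where g: "linear_on W Z g" "\<And>x. x \<in> p ` carrier V \<Longrightarrow> g x = f (s x)"
    using linear_on_extend[OF assms(2,3) linear_on_image_subspace[OF assms(1,2,4)]
        linear_on_comp[OF s(1) assms(5)]] by blast
  have "g (p x) = f x" if x: "x \<in> carrier V" for x
  proof -
    have sx: "s (p x) \<in> carrier V" using linear_onD(1)[OF s(1)] x by simp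
    have "p (s (p x) - x) = 0" using s(2) x sx by (simp add: linear_on_diff[OF assms(1,4)])
    then have "f (s (p x) - x) = 0" using ker x sx is_vspaceD(6)[OF assms(1)] by blast
    then show ?thesis using g(2) x sx by (simp add: linear_on_diff[OF assms(1,5)])
  qed
  then show ?thesis using that g by blast
qed

text \<open>The quotient by a subspace is realised inside the space itself, so that no coset type is needed.\<close>

lemma linear_on_with_kernel:
  assumes "is_vspace V" "subspace_of V U"
  obtains k where "linear_on V V k" "\<And>x. x \<in> carrier V \<Longrightarrow> k x = 0 \<longleftrightarrow> x \<in> U"
proof -
  interpret vector_space "scl V" using assms by (simp add: is_vspace_def)
  note U = subspace_ofD[OF assms]
  interpret P: vector_space_pair "scl V" "scl V" by unfold_locales
  \<comment> \<open>A left inverse of the inclusion of U is a projection g onto U, and x - g x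
    vanishes exactly on U.\<close>
  obtain g where g: "Vector_Spaces.linear (scl V) (scl V) g" "g ` UNIV \<subseteq> U" "\<forall>x\<in>U. g x = x"
    using P.linear_exists_left_inverse_on[OF _ U(3), of "\<lambda>x. x"] module_hom_ident
    by (auto simp: linear_iff inj_on_def)
  interpret g: Vector_Spaces.linear "scl V" "scl V" g by (rule g(1))
  have "linear_on V V (\<lambda>x. x - g x)"
    using U(2) g(2) is_vspaceD(6)[OF assms(1)]
    by (intro linear_onI) (auto simp: g.add g.scale scale_right_diff_distrib subset_iff)
  moreover have "x - g x = 0 \<longleftrightarrow> x \<in> U" for x
    using g(2,3) by (metis eq_iff_diff_eq_0 rangeI subsetD)
  ultimately show ?thesis using that by blast
qed

section \<open>Cosets and quotient spaces\<close>

lemma coset_eq_iff: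
  fixes V :: "('f::field, 'v::ab_group_add, 'm) vspace_scheme"
  assumes "is_vspace V" "subspace_of V U"
  shows "x +o U = y +o U \<longleftrightarrow> x - y \<in> U"
proof
  note U = subspace_ofD[OF assms]
  assume "x +o U = y +o U"
  then show "x - y \<in> U" using U(4) by (metis add.right_neutral set_minus_plus set_plus_intro2)
next
  note U = subspace_ofD[OF assms]
  assume d: "x - y \<in> U"
  have "x + u \<in> y +o U" if "u \<in> U" for u
    using U(5)[OF d that] by (simp add: set_minus_plus[symmetric] algebra_simps)
  moreover have "y + u \<in> x +o U" if "u \<in> U" for u
    using U(6)[OF that d] by (simp add: set_minus_plus[symmetric] algebra_simps)
  ultimately show "x +o U = y +o U" by (auto simp: elt_set_plus_def)
qed

lemma coset_add:
  assumes "is_vspace V" "subspace_of V U"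
  shows "(x +o U) + (y +o U) = (x + y) +o U"
proof -
  have "U + U = U" using subspace_ofD(4,5)[OF assms] by (force simp: set_plus_def)
  then show ?thesis by (simp add: set_plus_rearrange)
qed

lemma coset_scale:
  assumes "is_vspace V" "subspace_of V U"
  shows "quot_scl (scl V) U c (x +o U) = scl V c x +o U"
proof -
  interpret vector_space "scl V" using assms by (simp add: is_vspace_def)
  note U = subspace_ofD[OF assms]
  have "scl V c (x + u) +o U = scl V c x +o U" if "u \<in> U" for u
    using U(8)[OF that] by (simp add: coset_eq_iff[OF assms] algebra_simps)
  then have "\<And>z. z \<in> x +o U \<Longrightarrow> scl V c z +o U = scl V c x +o U"
    by (auto simp: elt_set_plus_def[of x])
  \<comment> \<open>All sets in the union are equal, but the union equals them only if the index set
    is nonempty.\<close>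
  moreover have "x +o U \<noteq> {}" using U(4) by blast
  ultimately show ?thesis unfolding quot_scl_def by (simp cong: SUP_cong)
qed

lemma quot_space_simps [simp]:
  "carrier (quot_space V U) = (\<lambda>v. v +o U) ` carrier V" "scl (quot_space V U) = quot_scl (scl V) U"
  by (simp_all add: quot_space_def quot_carrier_def)

lemma linear_on_coset:
  assumes "is_vspace V" "subspace_of V U"
  shows "linear_on V (quot_space V U) (\<lambda>x. x +o U)"
  by (rule linear_onI) (auto simp: coset_add[OF assms] coset_scale[OF assms])

text \<open>f is constant on each coset of U, so the image of a coset is a singleton. Extracting its
  element lets f descend to the quotient without a choice of representatives.\<close>

lemma coset_elim:
  fixes f :: "'v::ab_group_add \<Rightarrow> 'w::ab_group_add"
  assumes "is_vspace V" "subspace_of V U" "linear_on V W f"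
    "\<And>x. x \<in> U \<Longrightarrow> f x = 0" "x \<in> carrier V"
  shows "(THE y. y \<in> f ` (x +o U)) = f x"
proof -
  note U = subspace_ofD[OF assms(1,2)]
  have "f (x + u) = f x" if "u \<in> U" for u
    using that U(2) assms(4)[OF that] assms(5) by (simp add: linear_onD(2)[OF assms(3)] subset_iff)
  then have "f ` (x +o U) = {f x}" using U(4) by (force simp: elt_set_plus_def)
  then show ?thesis by simp
qed

lemma first_isomorphism:
  fixes f :: "'v::ab_group_add \<Rightarrow> 'w::ab_group_add"
  assumes "is_vspace V" "subspace_of V U" "linear_on V W f" "f ` carrier V = carrier W"
    and ker: "\<And>x. x \<in> carrier V \<Longrightarrow> f x = 0 \<longleftrightarrow> x \<in> U"
  shows "quot_space V U \<cong>\<^sub>v W"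
proof -
  note U = subspace_ofD[OF assms(1,2)]
  define h where "h C = (THE y. y \<in> f ` C)" for C
  have h: "h (x +o U) = f x" if "x \<in> carrier V" for x
    unfolding h_def by (rule coset_elim[OF assms(1-3) _ that]) (use ker U(2) in auto)
  have ha: "h (x +o U + (y +o U)) = h (x +o U) + h (y +o U)" if "x \<in> carrier V" "y \<in> carrier V" for x y
    using that by (simp add: h coset_add[OF assms(1,2)] linear_onD(2)[OF assms(3)] is_vspaceD(5)[OF assms(1)])
  have hs: "h (quot_scl (scl V) U c (x +o U)) = scl W c (h (x +o U))" if "x \<in> carrier V" for x c
    using that by (simp add: h coset_scale[OF assms(1,2)] linear_onD(3)[OF assms(3)] is_vspaceD(8)[OF assms(1)])
  have hc: "h (x +o U) \<in> carrier W" if "x \<in> carrier V" for x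
    using that by (simp add: h linear_onD(1)[OF assms(3)])
  have lin: "linear_on (quot_space V U) W h"
    by (rule linear_onI) (unfold quot_space_simps; elim imageE; simp only: ha hs hc)+
  have inj: "x +o U = y +o U" if "x \<in> carrier V" "y \<in> carrier V" "f x = f y" for x y
    using that ker[of "x - y"] is_vspaceD(6)[OF assms(1)]
    by (simp add: coset_eq_iff[OF assms(1,2)] linear_on_diff[OF assms(1,3)])
  have "inj_on h (carrier (quot_space V U))"
  proof (unfold quot_space_simps, intro inj_onI, elim imageE)
    fix C D x y assume "h C = h D" "C = x +o U" "D = y +o U" "x \<in> carrier V" "y \<in> carrier V"
    then show "C = D" using inj[of x y] by (simp add: h)
  qed
  moreover have "h ` carrier (quot_space V U) = carrier W"
    using assms(4) by (simp add: image_image h cong: image_cong)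
  ultimately show ?thesis using lin unfolding vspace_iso_def by (intro exI[of _ h] conjI bij_betw_imageI)
qed

section \<open>Isomorphisms of vector spaces and of quotients\<close>

lemma vspace_iso_trans:
  assumes "V \<cong>\<^sub>v W" "W \<cong>\<^sub>v Z"
  shows "V \<cong>\<^sub>v Z"
proof -
  obtain f where f: "linear_on V W f" "bij_betw f (carrier V) (carrier W)"
    using assms(1) by (auto simp: vspace_iso_def)
  obtain g where g: "linear_on W Z g" "bij_betw g (carrier W) (carrier Z)"
    using assms(2) by (auto simp: vspace_iso_def)
  show ?thesis unfolding vspace_iso_def
    using linear_on_comp[OF f(1) g(1)] bij_betw_trans[OF f(2) g(2)] by (auto simp: comp_def)
qed

text \<open>Closure of V is assumed in place of \<open>is_vspace V\<close> because V may be a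
  quotient space: its elements are sets, whose ambient type is no group.\<close>

lemma linear_on_inv_into:
  assumes "linear_on V W f" "bij_betw f (carrier V) (carrier W)"
    "\<And>x y. x \<in> carrier V \<Longrightarrow> y \<in> carrier V \<Longrightarrow> x + y \<in> carrier V"
    "\<And>c x. x \<in> carrier V \<Longrightarrow> scl V c x \<in> carrier V"
  shows "linear_on W V (inv_into (carrier V) f)"
proof -
  have i: "inj_on f (carrier V)" and s: "f ` carrier V = carrier W"
    using assms(2) by (simp_all add: bij_betw_def)
  let ?g = "inv_into (carrier V) f"
  have g: "?g y \<in> carrier V" "f (?g y) = y" if "y \<in> carrier W" for y
    using that s by (metis inv_into_into, metis f_inv_into_f)
  show ?thesis
  proof (rule linear_onI)
    fix x y assume *: "x \<in> carrier W" "y \<in> carrier W"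
    have "?g (x + y) = ?g (f (?g x + ?g y))" using * g linear_onD(2)[OF assms(1)] by simp
    then show "?g (x + y) = ?g x + ?g y" using inv_into_f_f[OF i] assms(3) g * by simp
  next
    fix c x assume *: "x \<in> carrier W"
    have "?g (scl W c x) = ?g (f (scl V c (?g x)))" using * g linear_onD(3)[OF assms(1)] by simp
    then show "?g (scl W c x) = scl V c (?g x)" using inv_into_f_f[OF i] assms(4) g * by simp
  qed (use g in auto)
qed

lemma vspace_iso_sym:
  assumes "V \<cong>\<^sub>v W"
    "\<And>x y. x \<in> carrier V \<Longrightarrow> y \<in> carrier V \<Longrightarrow> x + y \<in> carrier V"
    "\<And>c x. x \<in> carrier V \<Longrightarrow> scl V c x \<in> carrier V"
  shows "W \<cong>\<^sub>v V"
proof -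
  obtain f where f: "linear_on V W f" "bij_betw f (carrier V) (carrier W)"
    using assms(1) by (auto simp: vspace_iso_def)
  show ?thesis unfolding vspace_iso_def
    using linear_on_inv_into[OF f assms(2,3)] bij_betw_inv_into[OF f(2)] by blast
qed

lemma quot_space_iso_sym:
  assumes "is_vspace V" "subspace_of V U" "quot_space V U \<cong>\<^sub>v W"
  shows "W \<cong>\<^sub>v quot_space V U"
  by (rule vspace_iso_sym[OF assms(3)])
    (auto simp: coset_add[OF assms(1,2)] coset_scale[OF assms(1,2)] is_vspaceD[OF assms(1)])

lemma is_vspace_iso_sym:
  assumes "is_vspace V" "V \<cong>\<^sub>v W"
  shows "W \<cong>\<^sub>v V"
  by (rule vspace_iso_sym[OF assms(2)]) (auto simp: is_vspaceD[OF assms(1)])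

text \<open>Trades an isomorphism on cosets for a surjection on V with kernel U, so that the later
  arguments never handle cosets.\<close>

lemma quot_space_iso_lift:
  assumes "is_vspace V" "subspace_of V U" "quot_space V U \<cong>\<^sub>v W" "is_vspace W"
  obtains f where "linear_on V W f" "f ` carrier V = carrier W"
    "\<And>x. x \<in> carrier V \<Longrightarrow> f x = 0 \<longleftrightarrow> x \<in> U"
proof -
  obtain g where g: "linear_on (quot_space V U) W g"
    "bij_betw g (carrier (quot_space V U)) (carrier W)"
    using assms(3) by (auto simp: vspace_iso_def)
  let ?f = "\<lambda>x. g (x +o U)"
  have l: "linear_on V W ?f" using linear_on_comp[OF linear_on_coset[OF assms(1,2)] g(1)] .
  have "?f x = 0 \<longleftrightarrow> x \<in> U" if "x \<in> carrier V" for x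
  proof -
    have "?f x = 0 \<longleftrightarrow> ?f x = ?f 0" using linear_on_zero[OF assms(1) l] by simp
    also have "\<dots> \<longleftrightarrow> x +o U = 0 +o U"
      using inj_on_eq_iff[OF bij_betw_imp_inj_on[OF g(2)], of "x +o U" "0 +o U"] that
        is_vspaceD(4)[OF assms(1)] by (simp del: set_zero_plus)
    finally show ?thesis by (simp only: coset_eq_iff[OF assms(1,2)] diff_zero)
  qed
  moreover have "?f ` carrier V = carrier W" using g(2) by (simp add: bij_betw_def image_image)
  ultimately show ?thesis using that l by blast
qed

section \<open>Coordinate spaces and finite dimension\<close>

lemma vector_space_pointwise: "vector_space (\<lambda>(c::'f::field) (v::'i \<Rightarrow> 'f) i. c * v i)"
  by unfold_locales (auto simp: fun_eq_iff algebra_simps)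

lemma coord_space_simps [simp]:
  "carrier (coord_space n) = {v. \<forall>i\<ge>n. v i = 0}" "scl (coord_space n) = (\<lambda>c v i. c * v i)"
  by (simp_all add: coord_space_def)

lemma is_vspace_coord_space [simp]: "is_vspace (coord_space n :: ('f::field, nat \<Rightarrow> 'f) vspace)"
proof -
  interpret vector_space "\<lambda>(c::'f) (v::nat \<Rightarrow> 'f) i. c * v i" by (rule vector_space_pointwise)
  show ?thesis by (simp add: is_vspace_def vector_space_axioms subspace_def)
qed

lemma is_vspace_ground_field [simp]: "is_vspace (ground_field :: ('f::field, 'f) vspace)"
proof -
  interpret vector_space "(*) :: 'f \<Rightarrow> _" by unfold_locales (auto simp: algebra_simps)
  show ?thesis by (simp add: is_vspace_def vector_space_axioms)
qed

lemma basis_of_iso: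
  fixes f :: "'v::ab_group_add \<Rightarrow> 'w::ab_group_add"
  assumes "is_vspace V" "is_vspace W" "linear_on V W f" "bij_betw f (carrier V) (carrier W)"
    "basis_of V B"
  shows "basis_of W (f ` B)"
proof -
  interpret vector_space_pair "scl V" "scl W"
    using assms by (simp add: is_vspace_def vector_space_pair_def)
  obtain g where g: "Vector_Spaces.linear (scl V) (scl W) g" "\<And>x. x \<in> carrier V \<Longrightarrow> g x = f x"
    using linear_on_ambient[OF assms(1-3)] by blast
  have B: "B \<subseteq> carrier V" "vs1.independent B" "vs1.span B = carrier V"
    using assms(5) by (simp_all add: basis_of_def)
  have "inj_on g (vs1.span B)" using assms(4) g(2) B(3) by (simp add: bij_betw_def inj_on_def)
  then have "vs2.independent (g ` B)" using linear_independent_injective_image[OF g(1) B(2)] by simp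
  moreover have "g ` B = f ` B" using B(1) g(2) by (auto simp: subset_iff cong: image_cong)
  moreover have "vs2.span (f ` B) = carrier W"
    using linear_on_span_image[OF assms(1-3) B(1)] B(3) assms(4) by (simp add: bij_betw_def)
  ultimately show ?thesis using B(1) assms(4) image_mono[OF B(1), of f] by (simp add: basis_of_def bij_betw_def)
qed

lemma finite_span_basis:
  assumes "is_vspace V" "carrier V \<subseteq> module.span (scl V) C" "finite C"
  obtains B where "basis_of V B" "finite B" "card B \<le> card C"
proof -
  interpret vector_space "scl V" using assms by (simp add: is_vspace_def)
  obtain B where B: "basis_of V B" using basis_of_exists assms(1) by blast
  then have "finite B \<and> card B \<le> card C"
    using independent_span_bound[OF assms(3), of B] assms(2) by (auto simp: basis_of_def)
  then show ?thesis using that B by blast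
qed

lemma basis_of_card:
  assumes "is_vspace V" "basis_of V B" "basis_of V C" "finite B"
  shows "finite C" "card C = card B"
proof -
  interpret vector_space "scl V" using assms by (simp add: is_vspace_def)
  have B: "independent B" "span B = carrier V" "B \<subseteq> carrier V"
    and C: "independent C" "span C = carrier V" "C \<subseteq> carrier V"
    using assms by (auto simp: basis_of_def)
  show f: "finite C" using independent_span_bound[OF assms(4) C(1)] B C by simp
  show "card C = card B"
    using independent_span_bound[OF assms(4) C(1)] independent_span_bound[OF f B(1)] B C by simp
qed

lemma coordinates_iso:
  assumes "is_vspace V" "basis_of V B" "finite B"
  shows "V \<cong>\<^sub>v coord_space (card B)"
proof -
  interpret vector_space "scl V" using assms by (simp add: is_vspace_def)
  have B: "independent B" "span B = carrier V" "B \<subseteq> carrier V"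
    using assms by (auto simp: basis_of_def)
  obtain b where b: "bij_betw b {..<card B} B"
    using assms(3) by (metis ex_bij_betw_nat_finite lessThan_atLeast0)
  define f where "f x = (\<lambda>i. if i < card B then representation B x (b i) else 0)" for x
  have l: "linear_on V (coord_space (card B)) f"
  proof (rule linear_onI)
    fix x y assume "x \<in> carrier V" "y \<in> carrier V"
    then show "f (x + y) = f x + f y"
      unfolding f_def fun_eq_iff by (simp add: representation_add[OF B(1)] B(2))
  next
    fix c x assume "x \<in> carrier V"
    then show "f (scl V c x) = scl (coord_space (card B)) c (f x)"
      unfolding f_def by (simp add: representation_scale[OF B(1)] B(2) fun_eq_iff)
  qed (simp add: f_def)
  moreover have "inj_on f (carrier V)"
    unfolding inj_on_linear_iff[OF assms(1) l]
  proof (intro ballI impI)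
    fix x assume x: "x \<in> carrier V" "f x = 0"
    have "representation B x v = 0" if "v \<in> B" for v
    proof -
      have "v \<in> b ` {..<card B}" using that b by (simp add: bij_betw_def)
      then obtain i where "i < card B" "v = b i" by blast
      then show ?thesis using fun_cong[OF x(2), of i] by (simp add: f_def)
    qed
    then have "(\<Sum>v\<in>B. scl V (representation B x v) v) = 0" by simp
    then show "x = 0" using sum_representation_eq[OF B(1), of x B] B(2) x(1) assms(3) by simp
  qed
  moreover have "carrier (coord_space (card B)) \<subseteq> f ` carrier V"
  proof
    fix v :: "nat \<Rightarrow> 'a" assume v: "v \<in> carrier (coord_space (card B))"
    define x where "x = (\<Sum>i<card B. scl V (v i) (b i))"
    have bB: "b i \<in> B" if "i < card B" for i using b that by (auto simp: bij_betw_def)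
    have x: "x \<in> carrier V"
      unfolding x_def B(2)[symmetric] using bB by (intro span_sum span_scale) (auto intro: span_base)
    have "representation B x (b j) = v j" if j: "j < card B" for j
    proof -
      have "representation B x (b j) = (\<Sum>i<card B. v i * representation B (b i) (b j))"
        unfolding x_def using bB
        by (subst representation_sum[OF B(1)])
          (auto intro: span_scale span_base intro!: sum.cong simp: representation_scale[OF B(1) span_base])
      also have "\<dots> = (\<Sum>i<card B. if i = j then v i else 0)"
      proof (rule sum.cong)
        fix i assume "i \<in> {..<card B}"
        then have "b i = b j \<longleftrightarrow> i = j" "b i \<in> B"
          using bB j inj_on_eq_iff[OF bij_betw_imp_inj_on[OF b]] by auto
        then show "v i * representation B (b i) (b j) = (if i = j then v i else 0)"
          by (auto simp: representation_basis[OF B(1)])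
      qed simp
      finally show ?thesis using j by simp
    qed
    then have "f x = v" using v by (auto simp: f_def fun_eq_iff)
    then show "v \<in> f ` carrier V" using x by blast
  qed
  moreover have "f ` carrier V \<subseteq> carrier (coord_space (card B))" using l by (simp only: linear_on_def)
  ultimately show ?thesis unfolding vspace_iso_def
    by (intro exI[of _ f] conjI l bij_betw_imageI subset_antisym)
qed

definition unit_vec :: "nat \<Rightarrow> nat \<Rightarrow> 'f::field" where
  "unit_vec i = (\<lambda>j. if j = i then 1 else 0)"

lemma coord_space_basis:
  shows "basis_of (coord_space n :: ('f::field, nat \<Rightarrow> 'f) vspace) (unit_vec ` {..<n})"
    and "card (unit_vec ` {..<n} :: (nat \<Rightarrow> 'f) set) = n"
proof -
  let ?V = "coord_space n :: ('f, nat \<Rightarrow> 'f) vspace"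
  interpret vector_space "scl ?V" using is_vspaceD(1) is_vspace_coord_space by blast
  let ?e = "unit_vec :: nat \<Rightarrow> nat \<Rightarrow> 'f"
  have inj: "inj ?e"
  proof (rule injI)
    fix i k assume "?e i = ?e k"
    then have "?e i i = ?e k i" by simp
    then show "i = k" by (simp add: unit_vec_def split: if_splits)
  qed
  have coeff: "(\<Sum>i<n. scl ?V (u i) (?e i)) j = (if j < n then u j else 0)" for u j
  proof -
    have "(\<Sum>i<n. scl ?V (u i) (?e i)) j = (\<Sum>i<n. u i * ?e i j)"
      by (induction n) auto
    also have "\<dots> = (\<Sum>i<n. if i = j then u i else 0)" by (intro sum.cong) (auto simp: unit_vec_def)
    finally show ?thesis by simp
  qed
  have ind: "independent (?e ` {..<n})"
  proof (rule independent_if_scalars_zero)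
    fix f x assume *: "(\<Sum>x\<in>?e ` {..<n}. scl ?V (f x) x) = 0" and "x \<in> ?e ` {..<n}"
    then obtain i where i: "x = ?e i" "i < n" by auto
    have "(\<Sum>i<n. scl ?V (f (?e i)) (?e i)) = 0"
      using * by (subst (asm) sum.reindex) (auto intro: inj_on_subset[OF inj])
    then show "f x = 0" using coeff[of "\<lambda>i. f (?e i)" i] i by simp
  qed simp
  have "v \<in> span (?e ` {..<n})" if "v \<in> carrier ?V" for v
  proof -
    have "v = (\<Sum>i<n. scl ?V (v i) (?e i))"
      by (rule ext) (use that coeff[of v] in auto)
    also have "\<dots> \<in> span (?e ` {..<n})" by (intro span_sum span_scale span_base) auto
    finally show ?thesis .
  qed
  moreover have sub: "?e ` {..<n} \<subseteq> carrier ?V" by (auto simp: unit_vec_def)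
  ultimately show "basis_of ?V (?e ` {..<n})"
    unfolding basis_of_def using ind is_vspaceD(3)[OF is_vspace_coord_space, of n]
    by (auto simp: span_minimal dest: subsetD[OF span_minimal])
  show "card (?e ` {..<n}) = n" using card_image[OF inj_on_subset[OF inj]] by simp
qed

text \<open>Passes from dimension phrased by coordinates, the form that also fits quotient spaces,
  to dimension counted by bases, the form used in \<open>dim_le\<close>.\<close>

lemma iso_coord_space_iff_basis:
  fixes V :: "('f::field, 'v::ab_group_add, 'm) vspace_scheme"
  assumes "is_vspace V"
  shows "V \<cong>\<^sub>v coord_space n \<longleftrightarrow> (\<exists>B. basis_of V B \<and> finite B \<and> card B = n)"
proof
  assume "V \<cong>\<^sub>v coord_space n"
  then have "coord_space n \<cong>\<^sub>v V" using is_vspace_iso_sym[OF assms] by blast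
  then obtain f where f: "linear_on (coord_space n) V f" "bij_betw f (carrier (coord_space n)) (carrier V)"
    unfolding vspace_iso_def by blast
  let ?C = "unit_vec ` {..<n} :: (nat \<Rightarrow> 'f) set"
  note C = coord_space_basis(1)[of n, where ?'f = 'f] coord_space_basis(2)[of n, where ?'f = 'f]
  have "inj_on f ?C" using inj_on_subset[OF bij_betw_imp_inj_on[OF f(2)]] C(1) by (simp add: basis_of_def)
  then have "card (f ` ?C) = n" using C(2) by (simp add: card_image)
  then show "\<exists>B. basis_of V B \<and> finite B \<and> card B = n"
    using basis_of_iso[OF is_vspace_coord_space assms f C(1)] by blast
next
  assume "\<exists>B. basis_of V B \<and> finite B \<and> card B = n"
  then show "V \<cong>\<^sub>v coord_space n" using coordinates_iso[OF assms] by blast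
qed

text \<open>Rank and nullity with explicit bases: extend A to a basis B of V; then f maps B - A
  injectively onto a basis of W.\<close>

lemma basis_of_kernel_image:
  fixes f :: "'v::ab_group_add \<Rightarrow> 'w::ab_group_add"
  assumes "is_vspace V" "is_vspace W" "linear_on V W f" "f ` carrier V = carrier W"
    "basis_of (restr_space V {x \<in> carrier V. f x = 0}) A" "finite A" "basis_of W C" "finite C"
  obtains B where "basis_of V B" "finite B" "card B = card A + card C"
proof -
  interpret vector_space_pair "scl V" "scl W"
    using assms by (simp add: is_vspace_def vector_space_pair_def)
  let ?U = "{x \<in> carrier V. f x = 0}"
  have U: "subspace_of V ?U" using linear_on_kernel_subspace[OF assms(1-3)] .
  obtain B where B: "A \<subseteq> B" "basis_of V B"
    using basis_of_subspace_extend[OF assms(1) U assms(5)] by blast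
  obtain g where g: "Vector_Spaces.linear (scl V) (scl W) g" "\<And>x. x \<in> carrier V \<Longrightarrow> g x = f x"
    using linear_on_ambient[OF assms(1-3)] by blast
  have A: "vs1.independent A" "vs1.span A = ?U" "A \<subseteq> ?U"
    using assms(5) by (simp_all add: basis_of_def)
  have iB: "vs1.independent B" "vs1.span B = carrier V" "B \<subseteq> carrier V"
    using B(2) by (simp_all add: basis_of_def)
  let ?D = "B - A"
  have D: "vs1.independent ?D" "vs1.span ?D \<subseteq> carrier V" "?D \<subseteq> carrier V"
    using iB vs1.independent_mono vs1.span_mono[of ?D B] by auto
  \<comment> \<open>Such an x lies in the span of A and in the span of B - A. Its coordinates with
    respect to B are supported in both of these disjoint sets, hence are all zero.\<close>
  have "x = 0" if "x \<in> vs1.span ?D" "g x = 0" for x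
  proof -
    have xV: "x \<in> carrier V" using that(1) D(2) by blast
    then have xA: "x \<in> vs1.span A" using that g(2) A(2) by simp
    have "vs1.representation B x v = 0" for v
    proof (cases "v \<in> A")
      case True
      have "vs1.representation B x = vs1.representation ?D x"
        by (rule vs1.representation_extend) (use iB that in auto)
      then show ?thesis using True vs1.representation_ne_zero[of ?D x v] by auto
    next
      case False
      have "vs1.representation B x = vs1.representation A x"
        by (rule vs1.representation_extend) (use iB xA B in auto)
      then show ?thesis using False vs1.representation_ne_zero[of A x v] by auto
    qed
    then show ?thesis using vs1.sum_nonzero_representation_eq[OF iB(1), of x] iB(2) xV by simp
  qed
  then have inj: "inj_on g (vs1.span ?D)"
    using linear_inj_on_iff_eq_0[OF g(1), of "vs1.span ?D"] by simp
  have ind: "vs2.independent (g ` ?D)" by (rule linear_independent_injective_image[OF g(1) D(1) inj])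
  have gf: "g ` carrier V = carrier W" using g(2) assms(4) by (auto cong: image_cong)
  have "g ` B \<subseteq> insert 0 (g ` ?D)" using A(3) g(2) by auto
  then have "vs2.span (g ` B) \<subseteq> vs2.span (g ` ?D)" using vs2.span_mono[of "g ` B" "insert 0 (g ` ?D)"] by simp
  moreover have "vs2.span (g ` B) = carrier W" using linear_span_image[OF g(1), of B] iB(2) gf by simp
  moreover have "vs2.span (g ` ?D) \<subseteq> vs2.span (g ` B)" by (intro vs2.span_mono) auto
  ultimately have "vs2.span (g ` ?D) = carrier W" by (simp only: subset_antisym)
  moreover have "g ` ?D \<subseteq> carrier W" using image_mono[OF D(3), of g] gf by (simp only:)
  ultimately have bD: "basis_of W (g ` ?D)" using ind unfolding basis_of_def by (intro conjI)
  have i: "inj_on g ?D" using inj vs1.span_superset by (rule inj_on_subset)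
  have "finite (g ` ?D)" "card (g ` ?D) = card C" using basis_of_card[OF assms(2,7) bD assms(8)] by auto
  then have fD: "finite ?D" "card ?D = card C" using finite_image_iff[OF i] card_image[OF i] by simp_all
  have "B = A \<union> ?D" using B(1) by blast
  moreover have "card (A \<union> ?D) = card A + card ?D" using fD(1) assms(6) by (intro card_Un_disjoint) auto
  ultimately have "finite B" "card B = card A + card C" using fD assms(6) by (metis finite_UnI, metis)
  then show ?thesis using that B by blast
qed


section \<open>Triassociative algebras and lifts from free algebras\<close>

text \<open>Indexing the three products by one type lets every fact be proved once for a variable
  operation, and the eleven axioms become the table \<open>laws\<close>, shared by algebras and
  cocycles.\<close>

datatype op = LOp | ROp | MOp

primrec prd :: "('f, 'v) trialg \<Rightarrow> op \<Rightarrow> 'v \<Rightarrow> 'v \<Rightarrow> 'v" where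
  "prd A LOp = lprod A"
| "prd A ROp = rprod A"
| "prd A MOp = mprod A"

primrec cmp :: "('b, 'a) cochain \<Rightarrow> op \<Rightarrow> 'b \<Rightarrow> 'b \<Rightarrow> 'a" where
  "cmp f LOp = fst f"
| "cmp f ROp = fst (snd f)"
| "cmp f MOp = snd (snd f)"

definition mk_alg :: "'v set \<Rightarrow> ('f \<Rightarrow> 'v \<Rightarrow> 'v) \<Rightarrow> (op \<Rightarrow> 'v \<Rightarrow> 'v \<Rightarrow> 'v) \<Rightarrow> ('f, 'v) trialg" where
  "mk_alg C s P = \<lparr>carrier = C, scl = s, lprod = P LOp, rprod = P ROp, mprod = P MOp\<rparr>"

text \<open>\<open>(a, b, c, d)\<close> encodes the identity \<open>b (a x y) z = c x (d y z)\<close>, and for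
  cocycles \<open>f\<^sub>b (a x y) z = f\<^sub>c x (d y z)\<close>.\<close>

definition laws :: "(op \<times> op \<times> op \<times> op) set" where
  "laws = {(LOp, LOp, LOp, LOp), (ROp, ROp, ROp, ROp), (ROp, LOp, LOp, LOp), (ROp, ROp, ROp, LOp),
    (LOp, ROp, LOp, ROp), (MOp, LOp, LOp, LOp), (ROp, ROp, ROp, MOp), (LOp, MOp, LOp, MOp),
    (MOp, ROp, MOp, ROp), (ROp, MOp, MOp, LOp), (MOp, MOp, MOp, MOp)}"

lemma all_op: "(\<forall>k. P k) \<longleftrightarrow> P LOp \<and> P ROp \<and> P MOp"
  by (metis op.exhaust)

lemma mk_alg_simps [simp]:
  "carrier (mk_alg C s P) = C" "scl (mk_alg C s P) = s" "prd (mk_alg C s P) k = P k"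
  unfolding mk_alg_def by (simp, simp, cases k, simp_all)

lemma products_eq: "products A = range (prd A)"
proof -
  have "UNIV = {LOp, ROp, MOp}" using op.exhaust by auto
  then have "range (prd A) = prd A ` {LOp, ROp, MOp}" by (simp only:)
  then show ?thesis by (simp add: products_def)
qed

lemma triassociative_iff:
  "triassociative A \<longleftrightarrow> is_vspace A \<and> (\<forall>k. bilinear_on A A (prd A k)) \<and>
     (\<forall>(a, b, c, d)\<in>laws. \<forall>x\<in>carrier A. \<forall>y\<in>carrier A. \<forall>z\<in>carrier A.
        prd A b (prd A a x y) z = prd A c x (prd A d y z))"
  unfolding triassociative_def laws_def all_op by simp (simp only: Ball_def)

lemma tri_hom_iff:
  "tri_hom A B h \<longleftrightarrow> linear_on A B h \<and>
     (\<forall>k. \<forall>x\<in>carrier A. \<forall>y\<in>carrier A. h (prd A k x y) = prd B k (h x) (h y))"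
  unfolding tri_hom_def all_op by auto

lemma tri_homD:
  assumes "tri_hom A B h"
  shows "linear_on A B h"
    "x \<in> carrier A \<Longrightarrow> y \<in> carrier A \<Longrightarrow> h (prd A k x y) = prd B k (h x) (h y)"
    "x \<in> carrier A \<Longrightarrow> h x \<in> carrier B"
  using assms unfolding tri_hom_iff by (simp_all add: linear_on_def image_subset_iff)

lemma tri_ideal_iff:
  "tri_ideal A I \<longleftrightarrow> subspace_of A I \<and>
     (\<forall>k. \<forall>a\<in>carrier A. \<forall>x\<in>I. prd A k a x \<in> I \<and> prd A k x a \<in> I)"
  by (simp add: tri_ideal_def products_eq)

lemma center_iff:
  "z \<in> center A \<longleftrightarrow> z \<in> carrier A \<and> (\<forall>k. \<forall>x\<in>carrier A. prd A k z x = 0 \<and> prd A k x z = 0)"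
  by (simp add: center_def products_eq)

lemma cocycles_iff:
  "f \<in> cocycles B A \<longleftrightarrow> (\<forall>k. cmp f k \<in> bilinear_maps B A) \<and>
     (\<forall>(a, b, c, d)\<in>laws. \<forall>x\<in>carrier B. \<forall>y\<in>carrier B. \<forall>z\<in>carrier B.
        cmp f b (prd B a x y) z = cmp f c x (prd B d y z))"
proof -
  obtain l r m where f: "f = (l, r, m)" by (cases f) auto
  show ?thesis unfolding f cocycles_def laws_def all_op by (simp add: ball_conj_distrib conj_assoc)
qed

lemma bilinear_onD:
  assumes "bilinear_on V W f"
  shows "x \<in> carrier V \<Longrightarrow> y \<in> carrier V \<Longrightarrow> f x y \<in> carrier W"
    "x \<in> carrier V \<Longrightarrow> x' \<in> carrier V \<Longrightarrow> y \<in> carrier V \<Longrightarrow> f (x + x') y = f x y + f x' y"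
    "x \<in> carrier V \<Longrightarrow> y \<in> carrier V \<Longrightarrow> y' \<in> carrier V \<Longrightarrow> f x (y + y') = f x y + f x y'"
    "x \<in> carrier V \<Longrightarrow> y \<in> carrier V \<Longrightarrow> f (scl V c x) y = scl W c (f x y)"
    "x \<in> carrier V \<Longrightarrow> y \<in> carrier V \<Longrightarrow> f x (scl V c y) = scl W c (f x y)"
  using assms by (auto simp: bilinear_on_def linear_on_def image_subset_iff)

lemma bilinear_onI:
  assumes "\<And>x y. x \<in> carrier V \<Longrightarrow> y \<in> carrier V \<Longrightarrow> f x y \<in> carrier W"
    "\<And>x x' y. x \<in> carrier V \<Longrightarrow> x' \<in> carrier V \<Longrightarrow> y \<in> carrier V \<Longrightarrow> f (x + x') y = f x y + f x' y"
    "\<And>x y y'. x \<in> carrier V \<Longrightarrow> y \<in> carrier V \<Longrightarrow> y' \<in> carrier V \<Longrightarrow> f x (y + y') = f x y + f x y'"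
    "\<And>x y c. x \<in> carrier V \<Longrightarrow> y \<in> carrier V \<Longrightarrow> f (scl V c x) y = scl W c (f x y)"
    "\<And>x y c. x \<in> carrier V \<Longrightarrow> y \<in> carrier V \<Longrightarrow> f x (scl V c y) = scl W c (f x y)"
  shows "bilinear_on V W f"
  using assms by (auto simp: bilinear_on_def linear_on_def)

lemma triassociativeD:
  assumes "triassociative A"
  shows "is_vspace A" "bilinear_on A A (prd A k)"
    "x \<in> carrier A \<Longrightarrow> y \<in> carrier A \<Longrightarrow> prd A k x y \<in> carrier A"
    "(a, b, c, d) \<in> laws \<Longrightarrow> x \<in> carrier A \<Longrightarrow> y \<in> carrier A \<Longrightarrow> z \<in> carrier A \<Longrightarrow>
       prd A b (prd A a x y) z = prd A c x (prd A d y z)"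
proof -
  show *: "is_vspace A" "bilinear_on A A (prd A k)" using assms by (auto simp: triassociative_iff)
  show "x \<in> carrier A \<Longrightarrow> y \<in> carrier A \<Longrightarrow> prd A k x y \<in> carrier A" using bilinear_onD(1)[OF *(2)] .
  show "(a, b, c, d) \<in> laws \<Longrightarrow> x \<in> carrier A \<Longrightarrow> y \<in> carrier A \<Longrightarrow> z \<in> carrier A \<Longrightarrow>
       prd A b (prd A a x y) z = prd A c x (prd A d y z)"
    using assms unfolding triassociative_iff by blast
qed

lemma bilinear_diff:
  fixes f :: "'v::ab_group_add \<Rightarrow> 'v \<Rightarrow> 'w::ab_group_add"
  assumes "is_vspace V" "bilinear_on V W f" "x \<in> carrier V" "y \<in> carrier V" "z \<in> carrier V"
  shows "f (x - y) z = f x z - f y z" "f z (x - y) = f z x - f z y"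
proof -
  have "linear_on V W (\<lambda>x. f x z)" "linear_on V W (f z)" using assms(2,5) by (auto simp: bilinear_on_def)
  then show "f (x - y) z = f x z - f y z" "f z (x - y) = f z x - f z y"
    using linear_on_diff[OF assms(1) _ assms(3,4)] by blast+
qed

text \<open>The kernel of q is an ideal, so products of images are well defined. The result is a
  model of A modulo that kernel whose elements lie in the ambient type of W instead of being
  cosets.\<close>

lemma push_forward_algebra:
  fixes A :: "('f::field, 'v::ab_group_add) trialg" and W :: "('f, 'w::ab_group_add) vspace"
  assumes A: "triassociative A" and W: "is_vspace W" and q: "linear_on A W q"
    and ker: "\<And>k a x. a \<in> carrier A \<Longrightarrow> x \<in> carrier A \<Longrightarrow> q x = 0 \<Longrightarrow>
      q (prd A k a x) = 0 \<and> q (prd A k x a) = 0"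
  obtains B where "triassociative B" "carrier B = q ` carrier A" "scl B = scl W" "tri_hom A B q"
proof -
  note vA = triassociativeD(1)[OF A]
  note cA = triassociativeD(3)[OF A]
  note bA = triassociativeD(2)[OF A]
  define r where "r = inv_into (carrier A) q"
  define P where "P k u v = q (prd A k (r u) (r v))" for k u v
  define B where "B = mk_alg (q ` carrier A) (scl W) P"
  have r: "r (q x) \<in> carrier A" "q (r (q x)) = q x" if "x \<in> carrier A" for x
    using that unfolding r_def by (simp_all add: inv_into_into f_inv_into_f)
  have P: "P k (q x) (q y) = q (prd A k x y)" if "x \<in> carrier A" "y \<in> carrier A" for k x y
  proof -
    let ?x = "r (q x)" and ?y = "r (q y)"
    note rx = r(1)[OF that(1)] and ry = r(1)[OF that(2)]
    have "q (?x - x) = 0" "q (?y - y) = 0"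
      by (simp_all add: linear_on_diff[OF vA q] r that)
    \<comment> \<open>The chosen preimages are exchanged for x and y one factor at a time; each
      exchange changes the product by an element of the kernel.\<close>
    then have "q (prd A k (?x - x) ?y) = 0" "q (prd A k x (?y - y)) = 0"
      using ker[of ?y "?x - x" k] ker[of x "?y - y" k] is_vspaceD(6)[OF vA] that rx ry by simp_all
    then have "q (prd A k ?x ?y) = q (prd A k x ?y)" "q (prd A k x ?y) = q (prd A k x y)"
      by (simp_all add: bilinear_diff[OF vA bA] linear_on_diff[OF vA q] cA that rx ry)
    then show ?thesis unfolding P_def by (simp only:)
  qed
  note qs = linear_onD(2,3)[OF q, symmetric]
  have "subspace_of W (q ` carrier A)" using linear_on_image_subspace[OF vA W q] .
  then have vB: "is_vspace B" unfolding B_def using is_vspaceD(1)[OF W]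
    by (simp add: is_vspace_def subspace_of_def)
  have "bilinear_on B B (P k)" for k
    by (rule bilinear_onI; unfold B_def mk_alg_simps; elim imageE; hypsubst)
      (simp_all add: P qs cA bilinear_onD(2-5)[OF bA] is_vspaceD(5,8)[OF vA])
  moreover have "P b (P a x y) z = P c x (P d y z)"
    if "(a, b, c, d) \<in> laws" "x \<in> q ` carrier A" "y \<in> q ` carrier A" "z \<in> q ` carrier A" for a b c d x y z
    using that(2-4) by (elim imageE; hypsubst) (simp add: P cA triassociativeD(4)[OF A that(1)])
  ultimately have "triassociative B" unfolding triassociative_iff using vB by (simp add: B_def) blast
  moreover have "tri_hom A B q" unfolding tri_hom_iff using q
    by (simp add: B_def P linear_on_def)
  ultimately show ?thesis using that[of B] by (simp add: B_def)
qed

section \<open>Homomorphisms and copies of algebras inside function spaces\<close>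

lemma tri_hom_comp:
  assumes "tri_hom A B g" "tri_hom B C h"
  shows "tri_hom A C (\<lambda>x. h (g x))"
  unfolding tri_hom_iff
  using linear_on_comp[OF tri_homD(1)[OF assms(1)] tri_homD(1)[OF assms(2)]]
  by (simp add: tri_homD(2,3)[OF assms(1)] tri_homD(2)[OF assms(2)])

lemma tri_hom_inv_into:
  assumes "triassociative A" "tri_hom A B h" "bij_betw h (carrier A) (carrier B)"
  shows "tri_hom B A (inv_into (carrier A) h)"
proof -
  let ?g = "inv_into (carrier A) h"
  note v = triassociativeD(1)[OF assms(1)]
  have i: "inj_on h (carrier A)" and s: "h ` carrier A = carrier B"
    using assms(3) by (simp_all add: bij_betw_def)
  have g: "?g y \<in> carrier A" "h (?g y) = y" if "y \<in> carrier B" for y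
    using that unfolding s[symmetric] by (rule inv_into_into, rule f_inv_into_f)
  have "?g (prd B k x y) = prd A k (?g x) (?g y)" if "x \<in> carrier B" "y \<in> carrier B" for k x y
  proof -
    have "?g (prd B k x y) = ?g (h (prd A k (?g x) (?g y)))"
      using that by (simp add: tri_homD(2)[OF assms(2)] g)
    also have "\<dots> = prd A k (?g x) (?g y)"
      using that by (intro inv_into_f_f[OF i] triassociativeD(3)[OF assms(1)] g)
    finally show ?thesis .
  qed
  moreover have "linear_on B A ?g"
    by (rule linear_on_inv_into[OF tri_homD(1)[OF assms(2)] assms(3)])
      (simp_all add: is_vspaceD(5,8)[OF v])
  ultimately show ?thesis unfolding tri_hom_iff by (intro conjI allI ballI)
qed

text \<open>For the index type \<open>'b expr\<close> its elements are those of the test algebras in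
  \<open>free_on\<close>. An injective linear map into it is thus all that is required of the target
  of a lift.\<close>

definition fun_space :: "('f::field, 'i \<Rightarrow> 'f) vspace" where
  "fun_space = \<lparr>carrier = UNIV, scl = (\<lambda>c v i. c * v i)\<rparr>"

lemma fun_space_simps [simp]: "carrier fun_space = UNIV" "scl fun_space = (\<lambda>c v i. c * v i)"
  by (simp_all add: fun_space_def)

lemma is_vspace_fun_space [simp]: "is_vspace (fun_space :: ('f::field, 'i \<Rightarrow> 'f) vspace)"
proof -
  interpret vector_space "\<lambda>(c::'f) (v::'i \<Rightarrow> 'f) i. c * v i" by (rule vector_space_pointwise)
  show ?thesis by (simp add: is_vspace_def vector_space_axioms)
qed

text \<open>Transport of structure: because e is injective, the ideal condition on its kernel is
  trivial, and the pushed-forward algebra is isomorphic to B.\<close>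

lemma embedded_copy:
  fixes B :: "('f::field, 'v::ab_group_add) trialg" and e :: "'v \<Rightarrow> 'i \<Rightarrow> 'f"
  assumes B: "triassociative B" and e: "linear_on B fun_space e" "inj_on e (carrier B)"
  obtains C where "triassociative C" "tri_hom B C e" "bij_betw e (carrier B) (carrier C)"
proof -
  note v = triassociativeD(1)[OF B]
  have ker: "e (prd B k a x) = 0 \<and> e (prd B k x a) = 0"
    if "a \<in> carrier B" "x \<in> carrier B" "e x = 0" for k a x
  proof -
    have x: "x = 0" using that(2,3) e(2) unfolding inj_on_linear_iff[OF v e(1)] by simp
    have "prd B k a (0 - 0) = prd B k a 0 - prd B k a 0" "prd B k (0 - 0) a = prd B k 0 a - prd B k 0 a"
      by (rule bilinear_diff[OF v triassociativeD(2)[OF B] is_vspaceD(4)[OF v] is_vspaceD(4)[OF v] that(1)])+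
    then show ?thesis using linear_on_zero[OF v e(1)] by (simp add: x)
  qed
  obtain C where C: "triassociative C" "carrier C = e ` carrier B" "tri_hom B C e"
    using push_forward_algebra[OF B is_vspace_fun_space e(1)] ker by metis
  show ?thesis
    by (rule that[OF C(1,3)]) (use C(2) e(2) in \<open>simp add: bij_betw_def\<close>)
qed

lemma free_onD:
  fixes F :: "('f::field, 'b::ab_group_add) trialg" and B :: "('f, 'b expr \<Rightarrow> 'f) trialg"
  assumes "free_on F X" "triassociative B" "g ` X \<subseteq> carrier B"
  shows "\<exists>h. tri_hom F B h \<and> (\<forall>x\<in>X. h x = g x) \<and>
    (\<forall>h'. tri_hom F B h' \<and> (\<forall>x\<in>X. h' x = g x) \<longrightarrow> (\<forall>a\<in>carrier F. h' a = h a))"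
  by (rule assms(1)[unfolded free_on_def, THEN conjunct2, THEN conjunct2, THEN spec, THEN spec,
      THEN mp, OF conjI[OF assms(2,3)]])

text \<open>The universal property extends from the universe of the definition to every algebra
  that embeds linearly into it.\<close>

lemma free_on_lift:
  fixes F :: "('f::field, 'b::ab_group_add) trialg" and B :: "('f, 'v::ab_group_add) trialg"
    and e :: "'v \<Rightarrow> 'b expr \<Rightarrow> 'f"
  assumes F: "free_on F X" and B: "triassociative B" and e: "linear_on B fun_space e" "inj_on e (carrier B)"
    and g: "g ` X \<subseteq> carrier B"
  obtains h where "tri_hom F B h" "\<And>x. x \<in> X \<Longrightarrow> h x = g x"
proof -
  obtain C where C: "triassociative C" "tri_hom B C e" "bij_betw e (carrier B) (carrier C)"
    by (rule embedded_copy[OF B e]) (rule that)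
  have sub: "(\<lambda>x. e (g x)) ` X \<subseteq> carrier C" 
    using g by (intro image_subsetI tri_homD(3)[OF C(2)]) (simp add: image_subset_iff)
  from free_onD[OF F C(1) sub] obtain h where h: "tri_hom F C h" "\<forall>x\<in>X. h x = e (g x)"
    by (elim exE conjE) (rule that)
  have "tri_hom F B (\<lambda>x. inv_into (carrier B) e (h x))"
    using tri_hom_comp[OF h(1) tri_hom_inv_into[OF B C(2,3)]] .
  moreover have "inv_into (carrier B) e (h x) = g x" if "x \<in> X" for x
    using h(2) g inv_into_f_f[OF e(2), of "g x"] that by (simp add: image_subset_iff)
  ultimately show ?thesis by (rule that)
qed

text \<open>Uniqueness is transported like existence: compose both homomorphisms with e, use
  uniqueness for the copy of B, and cancel e by injectivity.\<close>

lemma free_on_hom_eq: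
  fixes F :: "('f::field, 'b::ab_group_add) trialg" and B :: "('f, 'v::ab_group_add) trialg"
    and e :: "'v \<Rightarrow> 'b expr \<Rightarrow> 'f"
  assumes F: "free_on F X" and B: "triassociative B" and e: "linear_on B fun_space e" "inj_on e (carrier B)"
    and h: "tri_hom F B h" "tri_hom F B h'" "\<And>x. x \<in> X \<Longrightarrow> h x = h' x" and a: "a \<in> carrier F"
  shows "h a = h' a"
proof -
  obtain C where C: "triassociative C" "tri_hom B C e" "bij_betw e (carrier B) (carrier C)"
    by (rule embedded_copy[OF B e]) (rule that)
  have X: "X \<subseteq> carrier F" using F by (simp add: free_on_def)
  have 1: "tri_hom F C (\<lambda>x. e (h x))" "tri_hom F C (\<lambda>x. e (h' x))"
    using tri_hom_comp[OF h(1) C(2)] tri_hom_comp[OF h(2) C(2)] .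
  have sub: "(\<lambda>x. e (h x)) ` X \<subseteq> carrier C" 
    using X by (intro image_subsetI tri_homD(3)[OF 1(1)]) (rule subsetD)
  from free_onD[OF F C(1) sub] obtain k where
    k: "\<forall>h'. tri_hom F C h' \<and> (\<forall>x\<in>X. h' x = e (h x)) \<longrightarrow> (\<forall>a\<in>carrier F. h' a = k a)"
    by (elim exE conjE) (rule that)
  have "\<forall>x\<in>X. e (h' x) = e (h x)" using h(3) by (intro ballI) (simp only:)
  then have "e (h' a) = k a" by (rule k[THEN spec, THEN mp, OF conjI[OF 1(2)], THEN bspec, OF _ a])
  moreover have "e (h a) = k a" by (rule k[THEN spec, THEN mp, OF conjI[OF 1(1)], THEN bspec, OF _ a]) simp
  ultimately have "e (h a) = e (h' a)" by simp
  then show ?thesis by (rule inj_onD[OF e(2) _ tri_homD(3)[OF h(1) a] tri_homD(3)[OF h(2) a]])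
qed

text \<open>Serves only as a surjection from expressions onto the natural numbers, available even
  when the type of generators has a single element.\<close>

primrec depth :: "'x expr \<Rightarrow> nat" where
  "depth (Gen x) = 0"
| "depth (Lp a b) = Suc (depth b)"
| "depth (Rp a b) = Suc (depth b)"
| "depth (Mp a b) = Suc (depth b)"

lemma depth_surj: "\<exists>t :: 'x expr. depth t = n"
proof (induction n)
  case 0
  show ?case by (rule exI[of _ "Gen undefined"]) simp
next
  case (Suc n)
  then obtain t :: "'x expr" where "depth t = n" by blast
  then show ?case by (intro exI[of _ "Lp t t"]) simp
qed

text \<open>An expression \<open>Gen v\<close> stores the coordinate of x at v for a fixed basis, an
  expression \<open>Lp s u\<close> stores the entry of the sequence a at the depth of u. So pairs of
  a scalar sequence and a vector embed jointly linearly, which leaves room beside V for a further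
  space of countable coordinates.\<close>

lemma expr_embedding:
  fixes V :: "('f::field, 'v::ab_group_add, 'm) vspace_scheme"
  assumes "is_vspace V"
  obtains e :: "(nat \<Rightarrow> 'f) \<Rightarrow> 'v \<Rightarrow> 'v expr \<Rightarrow> 'f" where
    "\<And>a b x y. x \<in> carrier V \<Longrightarrow> y \<in> carrier V \<Longrightarrow> e (a + b) (x + y) = e a x + e b y"
    "\<And>c a x. x \<in> carrier V \<Longrightarrow> e (\<lambda>i. c * a i) (scl V c x) = (\<lambda>t. c * e a x t)"
    "\<And>a x. x \<in> carrier V \<Longrightarrow> e a x = 0 \<Longrightarrow> a = 0 \<and> x = 0"
proof -
  interpret vector_space "scl V" using assms by (simp add: is_vspace_def)
  obtain B where "basis_of V B" using basis_of_exists[OF assms] by blast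
  then have B: "independent B" "span B = carrier V" by (auto simp: basis_of_def)
  define e :: "(nat \<Rightarrow> 'f) \<Rightarrow> 'v \<Rightarrow> 'v expr \<Rightarrow> 'f" where
    "e a x t = (case t of Gen v \<Rightarrow> representation B x v | Lp s u \<Rightarrow> a (depth u) | _ \<Rightarrow> 0)" for a x t
  have "e (a + b) (x + y) = e a x + e b y" if "x \<in> carrier V" "y \<in> carrier V" for a b x y
    using that by (intro ext) (simp add: e_def representation_add[OF B(1)] B(2) split: expr.split)
  moreover have "e (\<lambda>i. c * a i) (scl V c x) = (\<lambda>t. c * e a x t)" if "x \<in> carrier V" for c a x
    using that by (intro ext) (simp add: e_def representation_scale[OF B(1)] B(2) split: expr.split)
  moreover have "a = 0 \<and> x = 0" if x: "x \<in> carrier V" and z: "e a x = 0" for a x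
  proof
    have r: "representation B x v = 0" for v using fun_cong[OF z, of "Gen v"] by (simp add: e_def)
    show "x = 0" using sum_nonzero_representation_eq[OF B(1), of x] x unfolding B(2) r by simp
    have "a n = 0" for n
    proof -
      obtain u :: "'v expr" where "depth u = n" using depth_surj by blast
      then show ?thesis using fun_cong[OF z, of "Lp u u"] by (simp add: e_def)
    qed
    then show "a = 0" by (simp add: fun_eq_iff)
  qed
  ultimately show ?thesis using that by blast
qed

section \<open>Lifting a free presentation along a surjection\<close>

lemma free_presentationD:
  assumes "free_presentation F R \<pi> L"
  shows "triassociative F" "tri_ideal F R" "tri_hom F L \<pi>" "\<pi> ` carrier F = carrier L"
    "R = {x \<in> carrier F. \<pi> x = 0}" "\<exists>X. free_on F X"
  using assms by (auto simp: free_presentation_def free_triassociative_def free_on_def)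

text \<open>Send each generator to a preimage of its image in L. The composite with
  \<open>\<mu>\<close> agrees with \<open>\<pi>\<close> on generators, hence everywhere by
  uniqueness.\<close>

lemma free_presentation_lift:
  fixes F :: "('f::field, 'b::ab_group_add) trialg" and L :: "('f, 'l::ab_group_add) trialg"
    and K :: "('f, 'k::ab_group_add) trialg" and e :: "'k \<Rightarrow> 'b expr \<Rightarrow> 'f"
  assumes L: "triassociative L" and FR: "free_presentation F R \<pi> L"
    and K: "triassociative K" "tri_hom K L \<mu>" "\<mu> ` carrier K = carrier L"
    and e: "linear_on K fun_space e" "inj_on e (carrier K)"
  obtains \<sigma> where "tri_hom F K \<sigma>" "\<And>x. x \<in> carrier F \<Longrightarrow> \<mu> (\<sigma> x) = \<pi> x"
proof -
  note P = free_presentationD[OF FR]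
  note vF = triassociativeD(1)[OF P(1)] and vL = triassociativeD(1)[OF L]
    and vK = triassociativeD(1)[OF K(1)]
  obtain X where X: "free_on F X" using P(6) by blast
  then have XF: "X \<subseteq> carrier F" by (simp add: free_on_def)
  obtain s where s: "linear_on L K s" "\<And>y. y \<in> carrier L \<Longrightarrow> \<mu> (s y) = y"
    using linear_on_section_onto[OF vK vL tri_homD(1)[OF K(2)] K(3)] by blast
  have sX: "(\<lambda>x. s (\<pi> x)) ` X \<subseteq> carrier K"
    using XF tri_homD(3)[OF P(3)] linear_onD(1)[OF s(1)] by blast
  obtain \<sigma> where \<sigma>: "tri_hom F K \<sigma>" "\<And>x. x \<in> X \<Longrightarrow> \<sigma> x = s (\<pi> x)"
    using free_on_lift[OF X K(1) e sX] by blast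
  \<comment> \<open>The uniqueness argument takes place in L, so L needs an embedding too; it is
    obtained from that of K through the section s.\<close>
  have eL: "linear_on L fun_space (\<lambda>y. e (s y))" using linear_on_comp[OF s(1) e(1)] .
  have iL: "inj_on (\<lambda>y. e (s y)) (carrier L)"
    by (rule inj_onI) (metis inj_onD[OF e(2)] linear_onD(1)[OF s(1)] s(2))
  have "\<mu> (\<sigma> x) = \<pi> x" if "x \<in> carrier F" for x
  proof (rule free_on_hom_eq[OF X L eL iL tri_hom_comp[OF \<sigma>(1) K(2)] P(3) _ that])
    show "\<mu> (\<sigma> y) = \<pi> y" if "y \<in> X" for y
      using \<sigma>(2)[OF that] s(2)[of "\<pi> y"] tri_homD(3)[OF P(3), of y] XF that by auto
  qed
  then show ?thesis using that \<sigma>(1) by blast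
qed

section \<open>Central extensions and potentials of cocycles\<close>

lemma bilinear_maps_iff:
  "f \<in> bilinear_maps B A \<longleftrightarrow>
     bilinear_on B A f \<and> (\<forall>x y. x \<notin> carrier B \<or> y \<notin> carrier B \<longrightarrow> f x y = 0)"
  by (simp add: bilinear_maps_def)

text \<open>The central extension of L with factor set f: the scalar components of the factors do
  not enter a product, which makes the scalar summand central.\<close>

definition extension :: "('f::field, 'l::ab_group_add) trialg \<Rightarrow> ('l, 'f) cochain \<Rightarrow> ('f, 'l \<times> 'f) trialg" where
  "extension L f = mk_alg (carrier L \<times> UNIV) (\<lambda>c z. (scl L c (fst z), c * snd z))
     (\<lambda>k z w. (prd L k (fst z) (fst w), cmp f k (fst z) (fst w)))"

lemma extension_simps [simp]:
  "carrier (extension L f) = carrier L \<times> UNIV"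
  "scl (extension L f) c z = (scl L c (fst z), c * snd z)"
  "prd (extension L f) k z w = (prd L k (fst z) (fst w), cmp f k (fst z) (fst w))"
  by (simp_all add: extension_def)

text \<open>In the first component each axiom is an axiom of L, in the second it is the cocycle
  identity with the same entry in \<open>laws\<close>.\<close>

lemma triassociative_extension:
  assumes L: "triassociative L" and f: "f \<in> cocycles L ground_field"
  shows "triassociative (extension L f)"
proof -
  note vL = triassociativeD(1)[OF L]
  interpret L: vector_space "scl L" using is_vspaceD(1)[OF vL] .
  have bf: "bilinear_on L ground_field (cmp f k)" for k
    using f by (simp add: cocycles_iff bilinear_maps_iff)
  interpret E: vector_space "scl (extension L f)"
    by unfold_locales (auto simp: algebra_simps prod_eq_iff)
  have vE: "is_vspace (extension L f)"
    unfolding is_vspace_def E.subspace_def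
    using E.vector_space_axioms is_vspaceD(4)[OF vL] is_vspaceD(5,8)[OF vL]
    by (auto simp: zero_prod_def)
  have "bilinear_on (extension L f) (extension L f) (prd (extension L f) k)" for k
    by (rule bilinear_onI)
      (auto simp: bilinear_onD[OF triassociativeD(2)[OF L]] bilinear_onD[OF bf])
  moreover have "cmp f b (prd L a x y) z = cmp f c x (prd L d y z)"
    if "(a, b, c, d) \<in> laws" "x \<in> carrier L" "y \<in> carrier L" "z \<in> carrier L" for a b c d x y z
    using f that unfolding cocycles_iff by blast
  ultimately show ?thesis unfolding triassociative_iff using vE triassociativeD(4)[OF L] by auto
qed

text \<open>Says that the pullback of f along \<open>\<pi>\<close> becomes a coboundary on F, namely
  that of the negative of \<open>\<theta>\<close>.\<close>

definition potential ::
  "('f::field, 'b::ab_group_add) trialg \<Rightarrow> ('b \<Rightarrow> 'l) \<Rightarrow> ('l, 'f) cochain \<Rightarrow> ('b \<Rightarrow> 'f) \<Rightarrow> bool" where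
  "potential F \<pi> f \<theta> \<longleftrightarrow> linear_on F ground_field \<theta> \<and>
     (\<forall>k. \<forall>x\<in>carrier F. \<forall>y\<in>carrier F. \<theta> (prd F k x y) = cmp f k (\<pi> x) (\<pi> y))"

lemma potential_exists:
  fixes F :: "('f::field, 'b::ab_group_add) trialg" and L :: "('f, 'l::ab_group_add) trialg"
  assumes L: "triassociative L" and FR: "free_presentation F R \<pi> L"
    and f: "f \<in> cocycles L ground_field"
  obtains \<theta> where "potential F \<pi> f \<theta>"
proof -
  note P = free_presentationD[OF FR]
  note vF = triassociativeD(1)[OF P(1)] and vL = triassociativeD(1)[OF L]
  let ?E = "extension L f"
  note E = triassociative_extension[OF L f]
  note vE = triassociativeD(1)[OF E]
  have mu: "tri_hom ?E L fst" unfolding tri_hom_iff by (auto simp: linear_on_def)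
  obtain s where s: "linear_on L F s" "\<And>y. y \<in> carrier L \<Longrightarrow> \<pi> (s y) = y"
    using linear_on_section_onto[OF vF vL tri_homD(1)[OF P(3)] P(4)] by blast
  obtain e :: "(nat \<Rightarrow> 'f) \<Rightarrow> 'b \<Rightarrow> 'b expr \<Rightarrow> 'f" where e:
    "\<And>a b x y. x \<in> carrier F \<Longrightarrow> y \<in> carrier F \<Longrightarrow> e (a + b) (x + y) = e a x + e b y"
    "\<And>c a x. x \<in> carrier F \<Longrightarrow> e (\<lambda>i. c * a i) (scl F c x) = (\<lambda>t. c * e a x t)"
    "\<And>a x. x \<in> carrier F \<Longrightarrow> e a x = 0 \<Longrightarrow> a = 0 \<and> x = 0"
    using expr_embedding[OF vF] by blast
  \<comment> \<open>The scalar component occupies the sequence slot as a constant sequence. The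
    component in L, possibly of infinite dimension, goes through the section s into the slot for
    F.\<close>
  define j where "j z = e (\<lambda>i. snd z) (s (fst z))" for z
  have jl: "linear_on ?E fun_space j"
  proof (rule linear_onI)
    fix z w assume "z \<in> carrier ?E" "w \<in> carrier ?E"
    then show "j (z + w) = j z + j w"
      using e(1)[of "s (fst z)" "s (fst w)" "\<lambda>i. snd z" "\<lambda>i. snd w"]
      by (auto simp: j_def linear_onD[OF s(1)] plus_fun_def)
  next
    fix c z assume "z \<in> carrier ?E"
    then show "j (scl ?E c z) = scl fun_space c (j z)"
      using e(2)[of "s (fst z)" c "\<lambda>i. snd z"] by (auto simp: j_def linear_onD[OF s(1)])
  qed simp
  have ji: "inj_on j (carrier ?E)"
    unfolding inj_on_linear_iff[OF vE jl]
  proof (intro ballI impI)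
    fix z assume z: "z \<in> carrier ?E" "j z = 0"
    then have "(\<lambda>i. snd z) = (0 :: nat \<Rightarrow> 'f)" "s (fst z) = 0"
      using e(3)[of "s (fst z)" "\<lambda>i. snd z"] linear_onD(1)[OF s(1)] by (auto simp: j_def)
    moreover have "\<pi> 0 = 0" using linear_on_zero[OF vF tri_homD(1)[OF P(3)]] .
    ultimately show "z = 0" using s(2)[of "fst z"] z(1) by (auto simp: prod_eq_iff fun_eq_iff)
  qed
  have "fst ` carrier ?E = carrier L" by simp
  then obtain \<sigma> where \<sigma>: "tri_hom F ?E \<sigma>" "\<And>x. x \<in> carrier F \<Longrightarrow> fst (\<sigma> x) = \<pi> x"
    using free_presentation_lift[OF L FR E mu _ jl ji] by blast
  have "potential F \<pi> f (\<lambda>x. snd (\<sigma> x))"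
    unfolding potential_def using tri_homD(2)[OF \<sigma>(1)] linear_onD(2,3)[OF tri_homD(1)[OF \<sigma>(1)]] \<sigma>(2)
    by (auto simp: linear_on_def)
  then show ?thesis by (rule that)
qed


section \<open>Products modulo the relations\<close>

definition prods :: "('f, 'v) trialg \<Rightarrow> 'v set \<Rightarrow> 'v set \<Rightarrow> 'v set" where
  "prods A U V = {prd A k u v | k u v. u \<in> U \<and> v \<in> V}"

lemma prodsI: "u \<in> U \<Longrightarrow> v \<in> V \<Longrightarrow> prd A k u v \<in> prods A U V"
  by (auto simp: prods_def)

text \<open>A span of a union is the sum of the spans; as a single span the set is open to induction
  and to images under linear maps.\<close>

lemma lozenge_eq:
  assumes "is_vspace A"
  shows "lozenge A U V = module.span (scl A) (prods A U V)"
proof -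
  interpret vector_space "scl A" using assms by (simp add: is_vspace_def)
  have "prods A U V = {lprod A s t | s t. s \<in> U \<and> t \<in> V} \<union> {rprod A s t | s t. s \<in> U \<and> t \<in> V} \<union>
      {mprod A s t | s t. s \<in> U \<and> t \<in> V}" (is "_ = ?l \<union> ?r \<union> ?m")
    unfolding prods_def by (auto, metis prd.simps op.exhaust, (metis prd.simps)+)
  then show ?thesis by (simp add: lozenge_def prod_span_def span_Un set_plus_def) blast
qed

text \<open>For F and R this is the denominator S. It is kept general because it is also applied to
  K and M of a defining pair, where it vanishes since M is central.\<close>

definition mixed :: "('f::field, 'v::ab_group_add) trialg \<Rightarrow> 'v set \<Rightarrow> 'v set" where
  "mixed A I = lozenge A (carrier A) I + lozenge A I (carrier A)"

lemma mixed_eq: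
  assumes "is_vspace A"
  shows "mixed A I = module.span (scl A) (prods A (carrier A) I \<union> prods A I (carrier A))"
proof -
  interpret vector_space "scl A" using assms by (simp add: is_vspace_def)
  show ?thesis unfolding mixed_def lozenge_eq[OF assms] span_Un set_plus_def by blast
qed

lemma derived_eq:
  "is_vspace A \<Longrightarrow> derived A = module.span (scl A) (prods A (carrier A) (carrier A))"
  by (simp add: derived_def lozenge_eq)

lemma prods_subset_carrier:
  assumes "triassociative A" "U \<subseteq> carrier A" "V \<subseteq> carrier A"
  shows "prods A U V \<subseteq> carrier A"
  using assms(2,3) triassociativeD(3)[OF assms(1)] unfolding prods_def by blast

lemma subspace_of_derived:
  assumes "triassociative A"
  shows "subspace_of A (derived A)"
  unfolding derived_eq[OF triassociativeD(1)[OF assms]]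
  by (rule subspace_of_span[OF triassociativeD(1)[OF assms] prods_subset_carrier[OF assms]]) auto

lemma prd_derived:
  assumes "triassociative A" "x \<in> carrier A" "y \<in> carrier A"
  shows "prd A k x y \<in> derived A"
proof -
  note v = triassociativeD(1)[OF assms(1)]
  interpret vector_space "scl A" using is_vspaceD(1)[OF v] .
  show ?thesis unfolding derived_eq[OF v] by (intro span_base prodsI assms)
qed

lemma subspace_of_mixed:
  assumes "triassociative A" "I \<subseteq> carrier A"
  shows "subspace_of A (mixed A I)"
  unfolding mixed_eq[OF triassociativeD(1)[OF assms(1)]]
  using prods_subset_carrier[OF assms(1)] assms(2)
  by (intro subspace_of_span[OF triassociativeD(1)[OF assms(1)]]) auto

lemma prd_mixed:
  assumes "is_vspace A" "a \<in> carrier A" "x \<in> I"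
  shows "prd A k a x \<in> mixed A I" "prd A k x a \<in> mixed A I"
proof -
  interpret vector_space "scl A" using is_vspaceD(1)[OF assms(1)] .
  show "prd A k a x \<in> mixed A I" "prd A k x a \<in> mixed A I"
    unfolding mixed_eq[OF assms(1)] by (intro span_base UnI1 prodsI assms, intro span_base UnI2 prodsI assms)
qed

lemma mixed_subset:
  assumes A: "triassociative A" and I: "tri_ideal A I"
  shows "mixed A I \<subseteq> derived A \<inter> I"
proof -
  note v = triassociativeD(1)[OF A]
  interpret vector_space "scl A" using is_vspaceD(1)[OF v] .
  have s: "subspace_of A I" and IA: "I \<subseteq> carrier A" using I by (auto simp: tri_ideal_iff subspace_of_def)
  have "prods A (carrier A) I \<union> prods A I (carrier A) \<subseteq> derived A \<inter> I"
    using I IA prd_derived[OF A] unfolding prods_def tri_ideal_iff by blast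
  moreover have "subspace (derived A \<inter> I)"
    using subspace_of_inter[OF v subspace_of_derived[OF A] s] by (simp add: subspace_of_def)
  ultimately show ?thesis unfolding mixed_eq[OF v] by (rule span_minimal)
qed

lemma vanish_on_mixed:
  fixes f :: "'v::ab_group_add \<Rightarrow> 'w::ab_group_add"
  assumes A: "triassociative A" and "I \<subseteq> carrier A" "is_vspace W" "linear_on A W f"
    and z: "\<And>k a x. a \<in> carrier A \<Longrightarrow> x \<in> I \<Longrightarrow> f (prd A k a x) = 0 \<and> f (prd A k x a) = 0"
    and x: "x \<in> mixed A I"
  shows "f x = 0"
proof -
  note v = triassociativeD(1)[OF A]
  interpret W: vector_space "scl W" using is_vspaceD(1)[OF assms(3)] .
  have "linear_on A W (\<lambda>_. 0)" using is_vspaceD(4)[OF assms(3)] by (intro linear_onI) auto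
  then show ?thesis
    by (rule linear_on_eq_on_span[OF v assms(4) _ _ _ assms(3) x[unfolded mixed_eq[OF v]]])
      (use z prods_subset_carrier[OF A] assms(2) in \<open>auto simp: prods_def\<close>)
qed

lemma span_image_subset:
  fixes f :: "'v::ab_group_add \<Rightarrow> 'w::ab_group_add"
  assumes "is_vspace V" "is_vspace W" "linear_on V W f" "B \<subseteq> carrier V" "subspace_of W D"
    "\<And>b. b \<in> B \<Longrightarrow> f b \<in> D" "x \<in> module.span (scl V) B"
  shows "f x \<in> D"
proof -
  interpret W: vector_space "scl W" using is_vspaceD(1)[OF assms(2)] .
  have "W.span (f ` B) \<subseteq> D"
    using assms(5,6) by (intro W.span_minimal) (auto simp: subspace_of_def)
  then show ?thesis using linear_on_span_image[OF assms(1-4)] assms(7) by blast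
qed

text \<open>Modulo \<open>F \<lozenge> R + R \<lozenge> F\<close>, a product in \<open>F\<close> depends only on the images of its factors in \<open>L\<close>.\<close>

lemma derived_finite_modulo_mixed:
  assumes A: "triassociative A" and L: "triassociative L" and mu: "tri_hom A L \<mu>" "\<mu> ` carrier A = carrier L"
    and I: "I = {x \<in> carrier A. \<mu> x = 0}" and B: "basis_of L B" "finite B"
  obtains P where "finite P" "P \<subseteq> carrier A" "derived A \<subseteq> module.span (scl A) (P \<union> mixed A I)"
proof -
  note vA = triassociativeD(1)[OF A] and vL = triassociativeD(1)[OF L]
  note lm = tri_homD(1)[OF mu(1)]
  note bA = triassociativeD(2)[OF A] and cA = triassociativeD(3)[OF A]
  interpret vector_space "scl A" using is_vspaceD(1)[OF vA] .
  obtain s where s: "linear_on L A s" "\<And>y. y \<in> carrier L \<Longrightarrow> \<mu> (s y) = y"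
    using linear_on_section_onto[OF vA vL lm mu(2)] by blast
  note sc = linear_onD(1)[OF s(1)]
  have BL: "B \<subseteq> carrier L" "module.span (scl L) B = carrier L" using B(1) by (auto simp: basis_of_def)
  \<comment> \<open>Products of lifted basis vectors of L, one for each operation and each pair in
    B.\<close>
  define P where "P = (\<lambda>(k, b, c). prd A k (s b) (s c)) ` ({LOp, ROp, MOp} \<times> B \<times> B)"
  have fP: "finite P" using B(2) by (simp add: P_def)
  have sB: "s b \<in> carrier A" if "b \<in> B" for b using sc BL(1) that by blast
  have PA: "P \<subseteq> carrier A" unfolding P_def
    by (intro image_subsetI, elim SigmaE) (simp add: sB cA del: prd.simps)
  have IA: "I \<subseteq> carrier A" using I by auto
  let ?D = "span (P \<union> mixed A I)"
  have D: "subspace_of A ?D"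
    using subspace_of_span[OF vA, of "P \<union> mixed A I"] PA subspace_of_mixed[OF A IA]
    by (simp add: subspace_of_def)
  have lr: "linear_on L A (\<lambda>v. prd A k x (s v))" if "x \<in> carrier A" for k x
    by (rule linear_on_comp[OF s(1)]) (use that bA in \<open>auto simp: bilinear_on_def\<close>)
  have ll: "linear_on L A (\<lambda>v. prd A k (s v) x)" if "x \<in> carrier A" for k x
    by (rule linear_on_comp[OF s(1)]) (use that bA in \<open>auto simp: bilinear_on_def\<close>)
  have "k \<in> {LOp, ROp, MOp}" for k by (cases k) auto
  then have bb: "prd A k (s b) (s c) \<in> ?D" if "b \<in> B" "c \<in> B" for k b c
    using that unfolding P_def by (intro span_base) (auto intro!: image_eqI[of _ _ "(k, b, c)"] simp del: prd.simps)
  \<comment> \<open>Bilinearity is used one argument at a time: the second factor first passes from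
    B to its span L, then the first does.\<close>
  have bv: "prd A k (s b) (s v) \<in> ?D" if "b \<in> B" "v \<in> carrier L" for k b v
    by (rule span_image_subset[OF vL vA lr[OF sB[OF that(1)]] BL(1) D]) (use that(2) bb[OF that(1)] BL(2) in simp_all)
  have uv: "prd A k (s u) (s v) \<in> ?D" if "u \<in> carrier L" "v \<in> carrier L" for k u v
    by (rule span_image_subset[OF vL vA ll[OF sc[OF that(2)]] BL(1) D]) (use that(1) bv[OF _ that(2)] BL(2) in simp_all)
  have "prd A k x y \<in> ?D" if x: "x \<in> carrier A" and y: "y \<in> carrier A" for k x y
  proof -
    let ?x = "s (\<mu> x)" and ?y = "s (\<mu> y)"
    have m: "\<mu> x \<in> carrier L" "\<mu> y \<in> carrier L" using x y linear_onD(1)[OF lm] by blast+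
    have c: "?x \<in> carrier A" "?y \<in> carrier A" using m sc by blast+
    have "x - ?x \<in> I" "y - ?y \<in> I" unfolding I using x y m c s(2) is_vspaceD(6)[OF vA]
      by (auto simp: linear_on_diff[OF vA lm])
    then have "prd A k (x - ?x) y \<in> mixed A I" "prd A k ?x (y - ?y) \<in> mixed A I"
      using prd_mixed[OF vA] c y by blast+
    \<comment> \<open>The three terms telescope to the product of x and y; the first two contain a
      factor in I.\<close>
    then have "prd A k (x - ?x) y + prd A k ?x (y - ?y) + prd A k ?x ?y \<in> ?D"
      using uv[OF m] by (intro span_add) (auto intro: span_base)
    then show ?thesis using x y c by (simp add: bilinear_diff[OF vA bA])
  qed
  then have "derived A \<subseteq> ?D" unfolding derived_eq[OF vA] by (intro span_minimal) (auto simp: prods_def)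
  then show ?thesis using that fP PA by blast
qed

section \<open>The quotient of \<open>F' \<inter> R\<close> and its coordinates\<close>

lemma hopf_quotient_eq:
  "hopf_quotient F R = quot_space (restr_space F (derived F \<inter> R)) (mixed F R)"
  by (simp add: hopf_quotient_def mixed_def)

lemma hopf_subspaces:
  assumes "free_presentation F R \<pi> L"
  shows "is_vspace F" "subspace_of F R" "subspace_of F (derived F \<inter> R)"
    "is_vspace (restr_space F (derived F \<inter> R))"
    "subspace_of (restr_space F (derived F \<inter> R)) (mixed F R)"
proof -
  note P = free_presentationD[OF assms]
  show vF: "is_vspace F" using triassociativeD(1)[OF P(1)] .
  show R: "subspace_of F R" using P(2) by (simp add: tri_ideal_iff)
  show V: "subspace_of F (derived F \<inter> R)" using subspace_of_inter[OF vF subspace_of_derived[OF P(1)] R] .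
  show "is_vspace (restr_space F (derived F \<inter> R))" using subspace_ofD(1)[OF vF V] .
  show "subspace_of (restr_space F (derived F \<inter> R)) (mixed F R)"
    using subspace_of_mixed[OF P(1), of R] mixed_subset[OF P(1,2)] subspace_ofD(2)[OF vF R]
    by (simp add: subspace_of_def)
qed

text \<open>A map \<open>\<kappa>\<close> with kernel S models the quotient inside F. It sends all
  of \<open>F'\<close> into the span of the images of the finite set G.\<close>

lemma hopf_quotient_finite:
  fixes F :: "('f::field, 'b::ab_group_add) trialg" and L :: "('f, 'l::ab_group_add) trialg"
  assumes L: "triassociative L" and FR: "free_presentation F R \<pi> L" and B: "basis_of L B" "finite B"
  obtains n where "hopf_quotient F R \<cong>\<^sub>v coord_space n"
proof -
  note P = free_presentationD[OF FR]
  note H = hopf_subspaces[OF FR]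
  note vF = H(1)
  let ?V = "restr_space F (derived F \<inter> R)" and ?S = "mixed F R"
  interpret vector_space "scl F" using is_vspaceD(1)[OF vF] .
  obtain G where G: "finite G" "G \<subseteq> carrier F" "derived F \<subseteq> span (G \<union> ?S)"
    using derived_finite_modulo_mixed[OF P(1) L P(3,4,5) B] by blast
  have S: "subspace_of F ?S" using subspace_of_mixed[OF P(1)] subspace_ofD(2)[OF H(1,2)] .
  obtain \<kappa> where k: "linear_on F F \<kappa>" "\<And>x. x \<in> carrier F \<Longrightarrow> \<kappa> x = 0 \<longleftrightarrow> x \<in> ?S"
    using linear_on_with_kernel[OF vF S] by blast
  have VF: "derived F \<inter> R \<subseteq> carrier F" using subspace_ofD(2)[OF H(1,3)] .
  have kV: "linear_on ?V F \<kappa>" using k(1) VF by (auto simp: linear_on_def subset_iff)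
  let ?U = "\<kappa> ` (derived F \<inter> R)"
  have U: "subspace_of F ?U" using linear_on_image_subspace[OF H(4) vF kV] by simp
  have "\<kappa> ` (G \<union> ?S) \<subseteq> insert 0 (\<kappa> ` G)" using k(2) subspace_ofD(2)[OF vF S] by auto
  then have "span (\<kappa> ` (G \<union> ?S)) \<subseteq> span (\<kappa> ` G)"
    using span_mono[of "\<kappa> ` (G \<union> ?S)" "insert 0 (\<kappa> ` G)"] by simp
  moreover have "\<kappa> ` span (G \<union> ?S) = span (\<kappa> ` (G \<union> ?S))"
    using linear_on_span_image[OF vF vF k(1), of "G \<union> ?S"] G(2) subspace_ofD(2)[OF vF S] by simp
  ultimately have "?U \<subseteq> span (\<kappa> ` G)" using G(3) by blast
  then have "carrier (restr_space F ?U) \<subseteq> module.span (scl (restr_space F ?U)) (\<kappa> ` G)" by simp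
  then obtain C where C: "basis_of (restr_space F ?U) C" "finite C"
    using finite_span_basis[OF subspace_ofD(1)[OF vF U] _ finite_imageI[OF G(1)]] by blast
  have "hopf_quotient F R \<cong>\<^sub>v restr_space F ?U" unfolding hopf_quotient_eq
    by (rule first_isomorphism[OF H(4,5)]) (use kV k(2) VF in \<open>auto simp: linear_on_def\<close>)
  then have "hopf_quotient F R \<cong>\<^sub>v coord_space (card C)"
    using coordinates_iso[OF subspace_ofD(1)[OF vF U] C] vspace_iso_trans by blast
  then show ?thesis by (rule that)
qed

text \<open>The coordinates of the quotient are extended arbitrarily from
  \<open>F' \<inter> R\<close> to F. Being defined on R as well, \<open>\<phi>\<close> selects a
  complement there: its kernel in R.\<close>

lemma hopf_functional:
  fixes F :: "('f::field, 'b::ab_group_add) trialg"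
  assumes FR: "free_presentation F R \<pi> L" and n: "hopf_quotient F R \<cong>\<^sub>v coord_space n"
  obtains \<phi> where "linear_on F (coord_space n) \<phi>"
    "\<phi> ` (derived F \<inter> R) = carrier (coord_space n)"
    "\<And>x. x \<in> derived F \<inter> R \<Longrightarrow> \<phi> x = 0 \<longleftrightarrow> x \<in> mixed F R"
proof -
  note H = hopf_subspaces[OF FR]
  obtain f where f: "linear_on (restr_space F (derived F \<inter> R)) (coord_space n) f"
    "f ` carrier (restr_space F (derived F \<inter> R)) = carrier (coord_space n)"
    "\<And>x. x \<in> carrier (restr_space F (derived F \<inter> R)) \<Longrightarrow> f x = 0 \<longleftrightarrow> x \<in> mixed F R"
    using quot_space_iso_lift[OF H(4,5) n[unfolded hopf_quotient_eq] is_vspace_coord_space] by blast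
  obtain \<phi> where \<phi>: "linear_on F (coord_space n) \<phi>" "\<And>x. x \<in> derived F \<inter> R \<Longrightarrow> \<phi> x = f x"
    using linear_on_extend[OF H(1) is_vspace_coord_space H(3) f(1)] by blast
  show ?thesis
  proof (rule that[OF \<phi>(1)])
    have "\<phi> ` (derived F \<inter> R) = f ` (derived F \<inter> R)" by (rule image_cong[OF refl \<phi>(2)])
    then show "\<phi> ` (derived F \<inter> R) = carrier (coord_space n)" using f(2) by simp
    show "\<phi> x = 0 \<longleftrightarrow> x \<in> mixed F R" if "x \<in> derived F \<inter> R" for x
      using \<phi>(2)[OF that] f(3)[of x] that by simp
  qed
qed


section \<open>Cocycles and functionals\<close>

lemma cochain_eqI: "(\<And>k. cmp f k = cmp g k) \<Longrightarrow> f = g"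
  by (metis cmp.simps prod_eqI)

lemma cmp_simps [simp]:
  "cmp (f + g) k = cmp f k + cmp g k" "cmp 0 k = 0"
  "cmp (cochain_scl s c f) k = (\<lambda>x y. s c (cmp f k x y))"
  "cmp (coboundary B \<epsilon>) k x y =
     (if x \<in> carrier B \<and> y \<in> carrier B then - \<epsilon> (prd B k x y) else 0)"
  by (cases k; simp add: cochain_scl_def case_prod_beta coboundary_def Let_def)+

lemma cocyclesI:
  assumes "\<And>k. bilinear_on B A (cmp f k)"
    "\<And>k x y. x \<notin> carrier B \<Longrightarrow> cmp f k x y = 0" "\<And>k x y. y \<notin> carrier B \<Longrightarrow> cmp f k x y = 0"
    "\<And>a b c d x y z. (a, b, c, d) \<in> laws \<Longrightarrow> x \<in> carrier B \<Longrightarrow> y \<in> carrier B \<Longrightarrow> z \<in> carrier B \<Longrightarrow>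
       cmp f b (prd B a x y) z = cmp f c x (prd B d y z)"
  shows "f \<in> cocycles B A"
  using assms unfolding cocycles_iff bilinear_maps_iff by blast

lemma cocyclesD:
  assumes "f \<in> cocycles B A"
  shows "bilinear_on B A (cmp f k)"
    "x \<notin> carrier B \<Longrightarrow> cmp f k x y = 0" "y \<notin> carrier B \<Longrightarrow> cmp f k x y = 0"
    "(a, b, c, d) \<in> laws \<Longrightarrow> x \<in> carrier B \<Longrightarrow> y \<in> carrier B \<Longrightarrow> z \<in> carrier B \<Longrightarrow>
       cmp f b (prd B a x y) z = cmp f c x (prd B d y z)"
  using assms unfolding cocycles_iff bilinear_maps_iff by blast+

definition cocycle_space :: "('f::field, 'l::ab_group_add) trialg \<Rightarrow> ('f, ('l, 'f) cochain) vspace" where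
  "cocycle_space L = \<lparr>carrier = cocycles L ground_field, scl = cochain_scl (*)\<rparr>"

lemma cocycle_space_simps [simp]:
  "carrier (cocycle_space L) = cocycles L ground_field" "scl (cocycle_space L) = cochain_scl (*)"
  by (simp_all add: cocycle_space_def)

lemma cohomology2_eq:
  "cohomology2 L ground_field = quot_space (cocycle_space L) (coboundaries L ground_field)"
  by (simp add: cohomology2_def cocycle_space_def)

lemma is_vspace_cocycle_space: "is_vspace (cocycle_space L)"
proof -
  interpret vector_space "scl (cocycle_space L)"
    by unfold_locales (rule cochain_eqI, simp add: fun_eq_iff algebra_simps)+
  have "f + g \<in> cocycles L ground_field"
    if "f \<in> cocycles L ground_field" "g \<in> cocycles L ground_field" for f g
    by (rule cocyclesI)
      (auto intro!: bilinear_onI simp: bilinear_onD[OF cocyclesD(1)[OF that(1)]]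
        bilinear_onD[OF cocyclesD(1)[OF that(2)]] cocyclesD(2,3)[OF that(1)] cocyclesD(2,3)[OF that(2)]
        cocyclesD(4)[OF that(1)] cocyclesD(4)[OF that(2)] distrib_left)
  moreover have "cochain_scl (*) c f \<in> cocycles L ground_field" if "f \<in> cocycles L ground_field" for c f
    by (rule cocyclesI)
      (auto intro!: bilinear_onI simp: bilinear_onD[OF cocyclesD(1)[OF that]] distrib_left mult.left_commute
        cocyclesD(2,3)[OF that] cocyclesD(4)[OF that])
  moreover have "0 \<in> cocycles L ground_field"
    by (rule cocyclesI) (auto intro!: bilinear_onI)
  ultimately show ?thesis unfolding is_vspace_def subspace_def using vector_space_axioms by simp
qed

text \<open>If one factor lies in R, its image in L is 0, and the bilinear f vanishes there.\<close>

lemma potential_functional: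
  assumes F: "triassociative F" "subspace_of F R" and L: "is_vspace L" "tri_hom F L \<pi>" "R = {x \<in> carrier F. \<pi> x = 0}"
    and f: "f \<in> cocycles L ground_field" and t: "potential F \<pi> f \<theta>" and x: "x \<in> mixed F R"
  shows "\<theta> x = 0"
proof -
  have bf: "bilinear_on L ground_field (cmp f k)" for k using cocyclesD(1)[OF f] .
  have z: "cmp f k (\<pi> a) 0 = 0" "cmp f k 0 (\<pi> a) = 0" if "a \<in> carrier F" for k a
  proof -
    have m: "\<pi> a \<in> carrier L" using tri_homD(3)[OF L(2) that] .
    note z = is_vspaceD(4)[OF L(1)]
    have "cmp f k (\<pi> a) (0 - 0) = cmp f k (\<pi> a) 0 - cmp f k (\<pi> a) 0"
      "cmp f k (0 - 0) (\<pi> a) = cmp f k 0 (\<pi> a) - cmp f k 0 (\<pi> a)"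
      by (rule bilinear_diff[OF L(1) bf z z m])+
    then show "cmp f k (\<pi> a) 0 = 0" "cmp f k 0 (\<pi> a) = 0" by simp_all
  qed
  show ?thesis
  proof (rule vanish_on_mixed[OF F(1) _ is_vspace_ground_field _ _ x])
    show "R \<subseteq> carrier F" using L(3) by blast
    show "linear_on F ground_field \<theta>" using t by (simp add: potential_def)
    show "\<theta> (prd F k a y) = 0 \<and> \<theta> (prd F k y a) = 0" if "a \<in> carrier F" "y \<in> R" for k a y
      using t that z L(3) by (simp add: potential_def)
  qed
qed

lemma potential_unique:
  assumes F: "triassociative F" and t: "potential F \<pi> f \<theta>" "potential F \<pi> f \<theta>'" and x: "x \<in> derived F"
  shows "\<theta> x = \<theta>' x"
proof (rule linear_on_eq_on_span[OF triassociativeD(1)[OF F] _ _ _ _ is_vspace_ground_field])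
  show "linear_on F ground_field \<theta>" "linear_on F ground_field \<theta>'" using t by (simp_all add: potential_def)
  show "prods F (carrier F) (carrier F) \<subseteq> carrier F" by (rule prods_subset_carrier[OF F]) auto
  show "x \<in> module.span (scl F) (prods F (carrier F) (carrier F))"
    using x by (simp add: derived_eq[OF triassociativeD(1)[OF F]])
  show "\<theta> y = \<theta>' y" if "y \<in> prods F (carrier F) (carrier F)" for y
    using that t by (auto simp: prods_def potential_def)
qed

lemma potential_add:
  assumes "potential F \<pi> f \<theta>" "potential F \<pi> g \<eta>"
  shows "potential F \<pi> (f + g) (\<lambda>x. \<theta> x + \<eta> x)"
  using assms by (auto simp: potential_def linear_on_def algebra_simps)

lemma potential_scale:
  assumes "potential F \<pi> f \<theta>"
  shows "potential F \<pi> (cochain_scl (*) c f) (\<lambda>x. c * \<theta> x)"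
  using assms by (auto simp: potential_def linear_on_def algebra_simps)

lemma coboundary_cocycle:
  assumes L: "triassociative L" and e: "linear_on L ground_field \<epsilon>"
  shows "coboundary L \<epsilon> \<in> cocycles L ground_field"
proof (rule cocyclesI)
  note v = triassociativeD(1)[OF L]
  show "bilinear_on L ground_field (cmp (coboundary L \<epsilon>) k)" for k
    by (rule bilinear_onI)
      (simp_all add: is_vspaceD(5,8)[OF v] bilinear_onD[OF triassociativeD(2)[OF L]]
        linear_onD(2,3)[OF e])
qed (simp_all add: triassociativeD(3,4)[OF L])

lemma potential_coboundary:
  assumes "tri_hom F L \<pi>" "linear_on L ground_field \<epsilon>"
  shows "potential F \<pi> (coboundary L \<epsilon>) (\<lambda>x. - \<epsilon> (\<pi> x))"
  unfolding potential_def
  by (auto simp: tri_homD(2,3)[OF assms(1)] linear_onD(2,3)[OF assms(2)]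
      linear_onD(2,3)[OF tri_homD(1)[OF assms(1)]] intro!: linear_onI)

text \<open>As \<open>\<theta>\<close> kills S, its value on a product depends only on the images of
  the factors in L, and so descends to f. The cocycle identities are \<open>\<theta>\<close> applied
  to the axioms of F.\<close>

lemma cocycle_of_functional:
  fixes F :: "('f::field, 'b::ab_group_add) trialg" and L :: "('f, 'l::ab_group_add) trialg"
  assumes F: "triassociative F" and L: "triassociative L" and p: "tri_hom F L \<pi>" "\<pi> ` carrier F = carrier L"
    and R: "R = {x \<in> carrier F. \<pi> x = 0}"
    and l: "linear_on F ground_field \<theta>" "\<And>x. x \<in> mixed F R \<Longrightarrow> \<theta> x = 0"
  obtains f where "f \<in> cocycles L ground_field" "potential F \<pi> f \<theta>"
proof -
  note vF = triassociativeD(1)[OF F] and vL = triassociativeD(1)[OF L]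
  note bF = triassociativeD(2)[OF F] and cF = triassociativeD(3)[OF F]
  note lp = tri_homD(1)[OF p(1)] and hp = tri_homD(2)[OF p(1)]
  obtain s where s: "linear_on L F s" "\<And>y. y \<in> carrier L \<Longrightarrow> \<pi> (s y) = y"
    using linear_on_section_onto[OF vF vL lp p(2)] by blast
  note sc = linear_onD(1)[OF s(1)]
  \<comment> \<open>The value 0 off the carrier is the normal form demanded by
    \<open>bilinear_maps\<close>.\<close>
  define P where "P k x y = (if x \<in> carrier L \<and> y \<in> carrier L then \<theta> (prd F k (s x) (s y)) else 0)" for k x y
  define f where "f = (P LOp, P ROp, P MOp)"
  have f: "cmp f k = P k" for k by (cases k) (simp_all add: f_def)
  have key: "P k (\<pi> a) (\<pi> b) = \<theta> (prd F k a b)" if a: "a \<in> carrier F" and b: "b \<in> carrier F" for k a b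
  proof -
    let ?a = "s (\<pi> a)" and ?b = "s (\<pi> b)"
    have m: "\<pi> a \<in> carrier L" "\<pi> b \<in> carrier L" using a b linear_onD(1)[OF lp] by blast+
    have c: "?a \<in> carrier F" "?b \<in> carrier F" using m sc by blast+
    have "a - ?a \<in> R" "b - ?b \<in> R" unfolding R using a b m c s(2) is_vspaceD(6)[OF vF]
      by (auto simp: linear_on_diff[OF vF lp])
    then have "prd F k (a - ?a) b \<in> mixed F R" "prd F k ?a (b - ?b) \<in> mixed F R"
      using prd_mixed[OF vF] c b by blast+
    then have "\<theta> (prd F k (a - ?a) b) = 0" "\<theta> (prd F k ?a (b - ?b)) = 0" using l(2) by blast+
    then show ?thesis using a b c m by (simp add: P_def bilinear_diff[OF vF bF] linear_on_diff[OF vF l(1)] cF)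
  qed
  have "f \<in> cocycles L ground_field"
  proof (rule cocyclesI; unfold f)
    show "bilinear_on L ground_field (P k)" for k
      by (rule bilinear_onI; unfold p(2)[symmetric]; elim imageE; hypsubst)
        (simp_all add: key linear_onD(2,3)[OF lp, symmetric] is_vspaceD(5,8)[OF vF] cF
          bilinear_onD(2-5)[OF bF] linear_onD(2,3)[OF l(1)])
    fix a b c d x y z
    assume laws: "(a, b, c, d) \<in> laws" and L: "x \<in> carrier L" "y \<in> carrier L" "z \<in> carrier L"
    obtain u where u: "u \<in> carrier F" "x = \<pi> u" using L(1)[folded p(2)] by blast
    obtain v where v: "v \<in> carrier F" "y = \<pi> v" using L(2)[folded p(2)] by blast
    obtain w where w: "w \<in> carrier F" "z = \<pi> w" using L(3)[folded p(2)] by blast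
    have "P b (prd L a x y) z = \<theta> (prd F b (prd F a u v) w)"
      using key[OF cF[OF u(1) v(1)] w(1)] by (simp add: u v w hp)
    moreover have "P c x (prd L d y z) = \<theta> (prd F c u (prd F d v w))"
      using key[OF u(1) cF[OF v(1) w(1)]] by (simp add: u v w hp)
    ultimately show "P b (prd L a x y) z = P c x (prd L d y z)"
      using triassociativeD(4)[OF F laws u(1) v(1) w(1)] by simp
  qed (simp_all add: P_def)
  moreover have "potential F \<pi> f \<theta>" using l(1) key by (simp add: potential_def f)
  ultimately show ?thesis by (rule that)
qed

text \<open>On \<open>F'\<close> the kernel of \<open>\<pi>\<close> is \<open>F' \<inter> R\<close>,
  where \<open>\<theta>\<close> vanishes. So the negative of \<open>\<theta>\<close>, restricted to
  \<open>F'\<close>, factors through \<open>\<pi>\<close>; the factor, extended to L, is the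
  required \<open>\<epsilon>\<close>. Products of F lie in \<open>F'\<close>, so nothing more is
  needed.\<close>

lemma coboundary_of_vanishing_potential:
  fixes F :: "('f::field, 'b::ab_group_add) trialg" and L :: "('f, 'l::ab_group_add) trialg"
  assumes L: "triassociative L" and FR: "free_presentation F R \<pi> L"
    and f: "f \<in> cocycles L ground_field" and t: "potential F \<pi> f \<theta>"
    and z: "\<And>x. x \<in> derived F \<inter> R \<Longrightarrow> \<theta> x = 0"
  shows "f \<in> coboundaries L ground_field"
proof -
  note P = free_presentationD[OF FR]
  note vF = triassociativeD(1)[OF P(1)] and vL = triassociativeD(1)[OF L]
  note D = subspace_ofD[OF vF subspace_of_derived[OF P(1)]]
  let ?V = "restr_space F (derived F)"
  have lp: "linear_on ?V L \<pi>" using tri_homD(1)[OF P(3)] D(2) by (auto simp: linear_on_def subset_iff)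
  have "linear_on F ground_field \<theta>" using t by (simp add: potential_def)
  then have lt: "linear_on ?V ground_field (\<lambda>x. - \<theta> x)"
    using D(2) by (auto simp: linear_on_def subset_iff)
  have "- \<theta> x = 0" if "x \<in> carrier ?V" "\<pi> x = 0" for x
    using z[of x] that D(2) P(5) by auto
  then obtain \<epsilon> where e: "linear_on L ground_field \<epsilon>" "\<And>x. x \<in> carrier ?V \<Longrightarrow> \<epsilon> (\<pi> x) = - \<theta> x"
    using linear_on_factor[OF D(1) vL is_vspace_ground_field lp lt] by blast
  have "cmp f k x y = cmp (coboundary L \<epsilon>) k x y" for k x y
  proof (cases "x \<in> carrier L \<and> y \<in> carrier L")
    case True
    then have xy: "x \<in> \<pi> ` carrier F" "y \<in> \<pi> ` carrier F" unfolding P(4) by blast+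
    obtain a where a: "a \<in> carrier F" "x = \<pi> a" using xy(1) by blast
    obtain b where b: "b \<in> carrier F" "y = \<pi> b" using xy(2) by blast
    have "cmp f k x y = \<theta> (prd F k a b)" using t a b by (simp add: potential_def)
    also have "\<dots> = - \<epsilon> (\<pi> (prd F k a b))" using e(2) prd_derived[OF P(1) a(1) b(1)] by simp
    also have "\<dots> = - \<epsilon> (prd L k x y)" using tri_homD(2)[OF P(3) a(1) b(1)] a b by simp
    finally show ?thesis using True by simp
  next
    case False
    then show ?thesis using cocyclesD(2,3)[OF f] by auto
  qed
  then have "f = coboundary L \<epsilon>" by (intro cochain_eqI ext)
  then show ?thesis using e(1) by (auto simp: coboundaries_def)
qed

text \<open>A cocycle is sent to the values of a potential at n points of
  \<open>F' \<inter> R\<close> that form a basis modulo S. This map is onto, and its kernel consists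
  of the coboundaries.\<close>

lemma cohomology2_iso_coord_space:
  fixes F :: "('f::field, 'b::ab_group_add) trialg" and L :: "('f, 'l::ab_group_add) trialg"
  assumes L: "triassociative L" and FR: "free_presentation F R \<pi> L"
    and n: "hopf_quotient F R \<cong>\<^sub>v coord_space n"
  shows "cohomology2 L ground_field \<cong>\<^sub>v coord_space n"
    and "subspace_of (cocycle_space L) (coboundaries L ground_field)"
proof -
  note P = free_presentationD[OF FR] and H = hopf_subspaces[OF FR]
  note vF = H(1) and vL = triassociativeD(1)[OF L]
  note vZ = is_vspace_cocycle_space[of L]
  let ?V = "derived F \<inter> R" and ?e = "unit_vec :: nat \<Rightarrow> nat \<Rightarrow> 'f"
  obtain \<phi> where \<phi>: "linear_on F (coord_space n) \<phi>" "\<phi> ` ?V = carrier (coord_space n)"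
    "\<And>x. x \<in> ?V \<Longrightarrow> \<phi> x = 0 \<longleftrightarrow> x \<in> mixed F R"
    using hopf_functional[OF FR n] by blast
  have "\<exists>x. x \<in> ?V \<and> \<phi> x = ?e i" if "i < n" for i
  proof -
    have "?e i \<in> carrier (coord_space n)" using that by (simp add: unit_vec_def)
    then show ?thesis unfolding \<phi>(2)[symmetric] by auto
  qed
  \<comment> \<open>Representatives dual to the coordinates: the i-th is mapped by
    \<open>\<phi>\<close> to the i-th unit vector.\<close>
  then obtain r where r: "\<And>i. i < n \<Longrightarrow> r i \<in> ?V" "\<And>i. i < n \<Longrightarrow> \<phi> (r i) = ?e i" by metis
  \<comment> \<open>The chosen potentials need not depend linearly on f. Linearity of
    \<open>\<Phi>\<close> holds because any two potentials of a cocycle agree on \<open>F'\<close>,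
    which contains the evaluation points.\<close>
  define \<theta> where "\<theta> f = (SOME t. potential F \<pi> f t)" for f
  have \<theta>: "potential F \<pi> f (\<theta> f)" if "f \<in> cocycles L ground_field" for f
    unfolding \<theta>_def using potential_exists[OF L FR that] by (metis someI)
  define \<Phi> where "\<Phi> f = (\<lambda>i. if i < n then \<theta> f (r i) else 0)" for f
  have \<Phi>: "\<Phi> f = (\<lambda>i. if i < n then t (r i) else 0)"
    if "f \<in> cocycles L ground_field" "potential F \<pi> f t" for f t
    unfolding \<Phi>_def using potential_unique[OF P(1) \<theta>[OF that(1)] that(2)] r(1) by auto
  have lin: "linear_on (cocycle_space L) (coord_space n) \<Phi>"
  proof (rule linear_onI; unfold cocycle_space_simps)
    fix f g assume fg: "f \<in> cocycles L ground_field" "g \<in> cocycles L ground_field"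
    have "f + g \<in> cocycles L ground_field" using is_vspaceD(5)[OF vZ] fg by simp
    from \<Phi>[OF this potential_add[OF \<theta>[OF fg(1)] \<theta>[OF fg(2)]]]
    show "\<Phi> (f + g) = \<Phi> f + \<Phi> g" by (simp add: \<Phi>_def[of f] \<Phi>_def[of g] fun_eq_iff)
  next
    fix c f assume f: "f \<in> cocycles L ground_field"
    have "cochain_scl (*) c f \<in> cocycles L ground_field" using is_vspaceD(8)[OF vZ] f by simp
    from \<Phi>[OF this potential_scale[OF \<theta>[OF f]]]
    show "\<Phi> (cochain_scl (*) c f) = scl (coord_space n) c (\<Phi> f)" by (simp add: \<Phi>_def[of f] fun_eq_iff)
  qed (simp add: \<Phi>_def)
  have onto: "\<Phi> ` carrier (cocycle_space L) = carrier (coord_space n)"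
  proof (intro equalityI subsetI)
    fix v :: "nat \<Rightarrow> 'f" assume v: "v \<in> carrier (coord_space n)"
    \<comment> \<open>The combination of the coordinates of \<open>\<phi>\<close> with coefficients
      v takes the value v i at r i by duality.\<close>
    define t where "t x = (\<Sum>i<n. v i * \<phi> x i)" for x
    have lt: "linear_on F ground_field t"
      by (rule linear_onI)
        (simp_all add: t_def linear_onD(2,3)[OF \<phi>(1)] sum.distrib distrib_left sum_distrib_left mult.left_commute)
    have "t x = 0" if "x \<in> mixed F R" for x
    proof -
      have "x \<in> ?V" using that mixed_subset[OF P(1,2)] by blast
      then have "\<phi> x = 0" using \<phi>(3) that by blast
      then show ?thesis by (simp add: t_def)
    qed
    then obtain f where f: "f \<in> cocycles L ground_field" "potential F \<pi> f t"
      using cocycle_of_functional[OF P(1) L P(3,4,5) lt] by blast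
    have "t (r i) = v i" if "i < n" for i
    proof -
      have "t (r i) = (\<Sum>j<n. if j = i then v j else 0)"
        unfolding t_def by (intro sum.cong) (auto simp: r(2)[OF that] unit_vec_def)
      then show ?thesis using that by simp
    qed
    then have "\<Phi> f = v" using \<Phi>[OF f] v by (auto simp: fun_eq_iff)
    then show "v \<in> \<Phi> ` carrier (cocycle_space L)" using f(1) by auto
  qed (use linear_onD(1)[OF lin] in blast)
  have ker: "\<Phi> f = 0 \<longleftrightarrow> f \<in> coboundaries L ground_field" if f: "f \<in> cocycles L ground_field" for f
  proof
    assume z: "\<Phi> f = 0"
    let ?W = "restr_space F ?V"
    have VF: "?V \<subseteq> carrier F" using subspace_ofD(2)[OF vF H(3)] .
    have lt: "linear_on ?W ground_field (\<theta> f)"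
      using \<theta>[OF f] VF by (auto simp: potential_def linear_on_def subset_iff)
    have lp: "linear_on ?W (coord_space n) \<phi>" using \<phi>(1) VF by (auto simp: linear_on_def subset_iff)
    \<comment> \<open>On \<open>F' \<inter> R\<close> the potential vanishes wherever
      \<open>\<phi>\<close> does, so it factors through \<open>\<phi>\<close>. The factor g is
      determined by its values on the unit vectors, which are the entries of
      \<open>\<Phi> f\<close>.\<close>
    have "\<theta> f x = 0" if "x \<in> carrier ?W" "\<phi> x = 0" for x
      using potential_functional[OF P(1) H(2) vL P(3,5) f \<theta>[OF f], of x] that \<phi>(3)[of x] by simp
    then obtain g where g: "linear_on (coord_space n) ground_field g"
      "\<And>x. x \<in> carrier ?W \<Longrightarrow> g (\<phi> x) = \<theta> f x"
      using linear_on_factor[OF H(4) is_vspace_coord_space is_vspace_ground_field lp lt] by blast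
    have ge: "g u = 0" if "u \<in> ?e ` {..<n}" for u
    proof -
      obtain i where i: "i < n" "u = ?e i" using \<open>u \<in> ?e ` {..<n}\<close> by auto
      have "\<Phi> f i = 0" using z by simp
      then show ?thesis using g(2)[of "r i"] r[OF i(1)] i by (simp add: \<Phi>_def)
    qed
    have b: "basis_of (coord_space n) (?e ` {..<n})" using coord_space_basis(1) .
    have "g u = 0" if "u \<in> carrier (coord_space n)" for u
    proof (rule linear_on_eq_on_span[OF is_vspace_coord_space g(1) _ _ ge is_vspace_ground_field])
      show "linear_on (coord_space n) ground_field (\<lambda>_. 0 :: 'f)" by (rule linear_onI) auto
      show "?e ` {..<n} \<subseteq> carrier (coord_space n)" "u \<in> module.span (scl (coord_space n)) (?e ` {..<n})"
        using b that by (simp_all only: basis_of_def)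
    qed
    then have "\<theta> f x = 0" if "x \<in> ?V" for x
      using g(2)[of x] that \<phi>(2) by (metis imageI restr_space_simps(1))
    then show "f \<in> coboundaries L ground_field"
      by (rule coboundary_of_vanishing_potential[OF L FR f \<theta>[OF f]])
  next
    assume "f \<in> coboundaries L ground_field"
    then obtain \<epsilon> where e: "f = coboundary L \<epsilon>" "linear_on L ground_field \<epsilon>"
      by (auto simp: coboundaries_def)
    \<comment> \<open>The coboundary of \<open>\<epsilon>\<close> has a potential that factors
      through \<open>\<pi>\<close> and hence vanishes on R.\<close>
    have "\<epsilon> (\<pi> (r i)) = 0" if "i < n" for i
      using r(1)[OF that] P(5) linear_on_zero[OF vL e(2)] by auto
    then show "\<Phi> f = 0" using \<Phi>[OF f, of "\<lambda>x. - \<epsilon> (\<pi> x)"] potential_coboundary[OF P(3) e(2)]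
      by (auto simp: e(1) fun_eq_iff)
  qed
  have "coboundaries L ground_field \<subseteq> cocycles L ground_field"
    using coboundary_cocycle[OF L] by (auto simp: coboundaries_def)
  \<comment> \<open>That the coboundaries form a subspace is read off from their being the kernel of
    \<open>\<Phi>\<close>.\<close>
  then have "coboundaries L ground_field = {f \<in> carrier (cocycle_space L). \<Phi> f = 0}"
    using ker by auto
  then show sub: "subspace_of (cocycle_space L) (coboundaries L ground_field)"
    using linear_on_kernel_subspace[OF vZ is_vspace_coord_space lin] by simp
  show "cohomology2 L ground_field \<cong>\<^sub>v coord_space n" unfolding cohomology2_eq
    by (rule first_isomorphism[OF vZ sub lin onto]) (use ker in simp)
qed


section \<open>Covers and multipliers\<close>

lemma quot_alg_simps [simp]:
  "carrier (quot_alg A I) = (\<lambda>v. v +o I) ` carrier A" "scl (quot_alg A I) = quot_scl (scl A) I"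
  "prd (quot_alg A I) k = quot_prod (prd A k) I"
  unfolding quot_alg_def by (simp add: quot_carrier_def, simp, cases k, simp_all)

lemma coset_prd:
  assumes A: "triassociative A" and I: "tri_ideal A I" and xy: "x \<in> carrier A" "y \<in> carrier A"
  shows "quot_prod (prd A k) I (x +o I) (y +o I) = prd A k x y +o I"
proof -
  note v = triassociativeD(1)[OF A]
  have s: "subspace_of A I" and i: "\<And>k a x. a \<in> carrier A \<Longrightarrow> x \<in> I \<Longrightarrow> prd A k a x \<in> I \<and> prd A k x a \<in> I"
    using I by (auto simp: tri_ideal_iff)
  note U = subspace_ofD[OF v s]
  have eq: "prd A k a b +o I = prd A k x y +o I" if a: "a \<in> x +o I" and b: "b \<in> y +o I" for a b
  proof -
    have d: "a - x \<in> I" "b - y \<in> I" using a b by (simp_all only: set_plus_imp_minus)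
    have "x + (a - x) \<in> carrier A" "y + (b - y) \<in> carrier A"
      using d U(2) xy is_vspaceD(5)[OF v] by blast+
    then have c: "a \<in> carrier A" "b \<in> carrier A" by simp_all
    have "prd A k (a - x) b + prd A k x (b - y) \<in> I"
      using i[OF c(2) d(1)] i[OF xy(1) d(2)] U(5) by blast
    then have "prd A k a b - prd A k x y \<in> I"
      using c xy by (simp add: bilinear_diff[OF v triassociativeD(2)[OF A]])
    then show ?thesis by (simp only: coset_eq_iff[OF v s])
  qed
  have "x +o I \<noteq> {}" "y +o I \<noteq> {}" using U(4) by blast+
  then show ?thesis unfolding quot_prod_def by (simp add: eq cong: SUP_cong)
qed

lemma tri_hom_coset:
  assumes "triassociative A" "tri_ideal A I"
  shows "tri_hom A (quot_alg A I) (\<lambda>x. x +o I)"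
proof -
  note v = triassociativeD(1)[OF assms(1)]
  have s: "subspace_of A I" using assms(2) by (simp add: tri_ideal_iff)
  show ?thesis unfolding tri_hom_iff
    using linear_on_coset[OF v s] by (simp add: coset_prd[OF assms] linear_on_def)
qed

text \<open>Replaces the coset algebra in the definition of a defining pair by a surjection with
  kernel M, the form in which lifts from F can be used.\<close>

lemma iso_quot_alg_iff:
  fixes L :: "('f::field, 'l::ab_group_add) trialg" and K :: "('f, 'k::ab_group_add) trialg"
  assumes L: "triassociative L" and K: "triassociative K" and M: "tri_ideal K M"
  shows "L \<cong>\<^sub>t quot_alg K M \<longleftrightarrow>
    (\<exists>\<mu>. tri_hom K L \<mu> \<and> \<mu> ` carrier K = carrier L \<and> M = {x \<in> carrier K. \<mu> x = 0})"
proof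
  note vL = triassociativeD(1)[OF L] and vK = triassociativeD(1)[OF K]
  have s: "subspace_of K M" using M by (simp add: tri_ideal_iff)
  note U = subspace_ofD[OF vK s]
  let ?Q = "quot_alg K M"
  {
    assume "L \<cong>\<^sub>t ?Q"
    then obtain h where h: "tri_hom L ?Q h" "bij_betw h (carrier L) (carrier ?Q)"
      unfolding tri_iso_def by blast
    let ?g = "inv_into (carrier L) h" and ?\<mu> = "\<lambda>x. inv_into (carrier L) h (x +o M)"
    have bg: "bij_betw ?g (carrier ?Q) (carrier L)" using bij_betw_inv_into[OF h(2)] .
    have mu: "tri_hom K L ?\<mu>"
      by (rule tri_hom_comp[OF tri_hom_coset[OF K M] tri_hom_inv_into[OF L h]])
    have onto: "?\<mu> ` carrier K = carrier L" using bg by (simp add: bij_betw_def image_image)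
    have "?\<mu> x = 0 \<longleftrightarrow> x \<in> M" if "x \<in> carrier K" for x
    proof -
      have "?\<mu> 0 = 0" using linear_on_zero[OF vK tri_homD(1)[OF mu]] .
      then have "?\<mu> x = 0 \<longleftrightarrow> ?\<mu> x = ?\<mu> 0" by simp
      also have "\<dots> \<longleftrightarrow> x +o M = 0 +o M"
        by (rule inj_on_eq_iff[OF bij_betw_imp_inj_on[OF bg]]) (unfold quot_alg_simps, rule imageI[OF that], rule imageI[OF is_vspaceD(4)[OF vK]])
      finally show ?thesis by (simp only: coset_eq_iff[OF vK s] diff_zero)
    qed
    then have "M = {x \<in> carrier K. ?\<mu> x = 0}" using U(2) by blast
    with mu onto show "\<exists>\<mu>. tri_hom K L \<mu> \<and> \<mu> ` carrier K = carrier L \<and> M = {x \<in> carrier K. \<mu> x = 0}"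
      by (intro exI[of _ ?\<mu>] conjI)
  next
    assume "\<exists>\<mu>. tri_hom K L \<mu> \<and> \<mu> ` carrier K = carrier L \<and> M = {x \<in> carrier K. \<mu> x = 0}"
    then obtain \<mu> where mu: "tri_hom K L \<mu>" "\<mu> ` carrier K = carrier L" "M = {x \<in> carrier K. \<mu> x = 0}"
      by blast
    note lm = tri_homD(1)[OF mu(1)]
    obtain t where t: "linear_on L K t" "\<And>y. y \<in> carrier L \<Longrightarrow> \<mu> (t y) = y"
      using linear_on_section_onto[OF vK vL lm mu(2)] by blast
    note tc = linear_onD(1)[OF t(1)]
    have eq: "x +o M = y +o M \<longleftrightarrow> \<mu> x = \<mu> y" if "x \<in> carrier K" "y \<in> carrier K" for x y
      unfolding coset_eq_iff[OF vK s] unfolding mu(3)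
      using that is_vspaceD(6)[OF vK] by (simp add: linear_on_diff[OF vK lm])
    have "t (prd L k x y) +o M = quot_prod (prd K k) M (t x +o M) (t y +o M)"
      if "x \<in> carrier L" "y \<in> carrier L" for k x y
      using that by (simp add: coset_prd[OF K M] tc eq triassociativeD(3)[OF K] triassociativeD(3)[OF L]
          t(2) tri_homD(2)[OF mu(1)])
    moreover have "linear_on L ?Q (\<lambda>y. t y +o M)"
      using linear_on_comp[OF t(1) linear_on_coset[OF vK s]] by (simp add: linear_on_def)
    ultimately have "tri_hom L ?Q (\<lambda>y. t y +o M)" unfolding tri_hom_iff quot_alg_simps by blast
    moreover have "inj_on (\<lambda>y. t y +o M) (carrier L)"
    proof (rule inj_onI)
      fix x y assume "x \<in> carrier L" "y \<in> carrier L" "t x +o M = t y +o M"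
      then show "x = y" using eq[OF tc tc, of x y] t(2)[of x] t(2)[of y] by simp
    qed
    moreover have "(\<lambda>y. t y +o M) ` carrier L = carrier ?Q"
    proof (unfold quot_alg_simps, intro equalityI subsetI)
      fix C assume "C \<in> (\<lambda>v. v +o M) ` carrier K"
      then obtain x where x: "x \<in> carrier K" "C = x +o M" by blast
      have m: "\<mu> x \<in> carrier L" using linear_onD(1)[OF lm x(1)] .
      then have "x +o M = t (\<mu> x) +o M" using eq[OF x(1) tc[OF m]] t(2)[OF m] by simp
      then show "C \<in> (\<lambda>y. t y +o M) ` carrier L" using m x(2) by blast
    qed (use tc in blast)
    ultimately show "L \<cong>\<^sub>t ?Q" unfolding tri_iso_def bij_betw_def by blast
  }
qed

text \<open>The lift \<open>\<sigma>\<close> of the free presentation maps \<open>F' \<inter> R\<close> onto \<open>M\<close> and kills \<open>F \<lozenge> R + R \<lozenge> F\<close>.\<close>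

lemma defining_pair_dimension:
  fixes F :: "('f::field, 'b::ab_group_add) trialg" and L :: "('f, 'l::ab_group_add) trialg"
    and K :: "('f, 'k::ab_group_add) trialg"
  assumes L: "triassociative L" and FR: "free_presentation F R \<pi> L"
    and n: "hopf_quotient F R \<cong>\<^sub>v coord_space n" and B: "basis_of L B" "finite B"
    and KM: "defining_pair L K M"
  obtains A C where "basis_of (restr_space K M) A" "finite A" "card A \<le> n"
    "basis_of K C" "finite C" "card C = card A + card B"
proof -
  note P = free_presentationD[OF FR] and H = hopf_subspaces[OF FR]
  have K: "triassociative K" and M: "tri_ideal K M" and Mc: "M \<subseteq> center K" and Md: "M \<subseteq> derived K"
    and iso: "L \<cong>\<^sub>t quot_alg K M" using KM by (auto simp: defining_pair_def)
  note vF = H(1) and vL = triassociativeD(1)[OF L] and vK = triassociativeD(1)[OF K]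
  obtain \<mu> where mu: "tri_hom K L \<mu>" "\<mu> ` carrier K = carrier L" "M = {x \<in> carrier K. \<mu> x = 0}"
    using iso unfolding iso_quot_alg_iff[OF L K M] by blast
  note lm = tri_homD(1)[OF mu(1)]
  interpret vector_space "scl K" using is_vspaceD(1)[OF vK] .
  have s: "subspace_of K M" using M by (simp add: tri_ideal_iff)
  note vM = subspace_ofD(1)[OF vK s] and MK = subspace_ofD(2)[OF vK s]
  have cen: "prd K k z x = 0" "prd K k x z = 0" if "z \<in> M" "x \<in> carrier K" for k x z
    using that Mc by (auto simp: center_iff subset_iff)
  obtain G where G: "finite G" "G \<subseteq> carrier K" "derived K \<subseteq> span (G \<union> mixed K M)"
    using derived_finite_modulo_mixed[OF K L mu B] by blast
  have "linear_on K K (\<lambda>x. x)" by (rule linear_onI) auto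
  \<comment> \<open>Every product with a factor in the central ideal M is 0, so
    \<open>mixed K M\<close> is zero and G alone spans \<open>derived K\<close>. This bounds M, and
    with it K, before any lift is available.\<close>
  then have "x = 0" if "x \<in> mixed K M" for x
    by (rule vanish_on_mixed[OF K MK vK _ _ that]) (use cen in blast)
  then have "mixed K M \<subseteq> {0}" by blast
  then have "span (G \<union> mixed K M) \<subseteq> span (insert 0 G)" by (intro span_mono) blast
  then have MG: "M \<subseteq> span G" using Md G(3) by simp
  then have "carrier (restr_space K M) \<subseteq> module.span (scl (restr_space K M)) G" by simp
  then obtain A where A: "basis_of (restr_space K M) A" "finite A"
    using finite_span_basis[OF vM _ G(1)] by blast
  obtain C where C: "basis_of K C" "finite C" "card C = card A + card B"
    using basis_of_kernel_image[OF vK vL lm mu(2) A(1)[unfolded mu(3)] A(2) B] by blast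
  obtain g where g: "linear_on K (coord_space (card C)) g" "bij_betw g (carrier K) (carrier (coord_space (card C)))"
    using coordinates_iso[OF vK C(1,2)] unfolding vspace_iso_def by blast
  obtain e :: "(nat \<Rightarrow> 'f) \<Rightarrow> 'b \<Rightarrow> 'b expr \<Rightarrow> 'f" where e:
    "\<And>a b x y. x \<in> carrier F \<Longrightarrow> y \<in> carrier F \<Longrightarrow> e (a + b) (x + y) = e a x + e b y"
    "\<And>c a x. x \<in> carrier F \<Longrightarrow> e (\<lambda>i. c * a i) (scl F c x) = (\<lambda>t. c * e a x t)"
    "\<And>a x. x \<in> carrier F \<Longrightarrow> e a x = 0 \<Longrightarrow> a = 0 \<and> x = 0"
    using expr_embedding[OF vF] by blast
  note zF = is_vspaceD(4)[OF vF]
  interpret F: vector_space "scl F" using is_vspaceD(1)[OF vF] .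
  \<comment> \<open>K has finite dimension, so its coordinates fit into the sequence slot alone; its
    type may be unrelated to that of F.\<close>
  define j where "j x = e (g x) 0" for x
  have jl: "linear_on K fun_space j"
  proof (rule linear_onI)
    fix x y assume "x \<in> carrier K" "y \<in> carrier K"
    then show "j (x + y) = j x + j y"
      using e(1)[OF zF zF, of "g x" "g y"] by (simp add: j_def linear_onD(2)[OF g(1)])
  next
    fix c x assume "x \<in> carrier K"
    then show "j (scl K c x) = scl fun_space c (j x)"
      using e(2)[OF zF, of c "g x"] by (simp add: j_def linear_onD(3)[OF g(1)])
  qed simp
  have ji: "inj_on j (carrier K)" unfolding inj_on_linear_iff[OF vK jl]
  proof (intro ballI impI)
    fix x assume x: "x \<in> carrier K" "j x = 0"
    then have "g x = 0" using e(3)[OF zF, of "g x"] by (simp add: j_def)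
    then show "x = 0" using bij_betw_imp_inj_on[OF g(2)] x(1) unfolding inj_on_linear_iff[OF vK g(1)] by blast
  qed
  obtain \<sigma> where \<sigma>: "tri_hom F K \<sigma>" "\<And>x. x \<in> carrier F \<Longrightarrow> \<mu> (\<sigma> x) = \<pi> x"
    using free_presentation_lift[OF L FR K mu(1,2) jl ji] by blast
  note ls = tri_homD(1)[OF \<sigma>(1)] and hs = tri_homD(2)[OF \<sigma>(1)] and cs = tri_homD(3)[OF \<sigma>(1)]
  have RF: "R \<subseteq> carrier F" using subspace_ofD(2)[OF vF H(2)] .
  have sR: "\<sigma> x \<in> M" if "x \<in> R" for x using that \<sigma>(2)[of x] cs[of x] P(5) mu(3) by auto
  have sS: "\<sigma> x = 0" if "x \<in> mixed F R" for x
    by (rule vanish_on_mixed[OF P(1) RF vK ls _ that])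
      (use cen sR cs hs RF in \<open>simp add: subset_iff\<close>)
  obtain \<phi> where \<phi>: "linear_on F (coord_space n) \<phi>" "\<phi> ` (derived F \<inter> R) = carrier (coord_space n)"
    "\<And>x. x \<in> derived F \<inter> R \<Longrightarrow> \<phi> x = 0 \<longleftrightarrow> x \<in> mixed F R"
    using hopf_functional[OF FR n] by blast
  let ?V = "restr_space F (derived F \<inter> R)"
  have lp: "linear_on ?V (coord_space n) \<phi>" using \<phi>(1) RF by (auto simp: linear_on_def subset_iff)
  have lsV: "linear_on ?V K \<sigma>" using ls RF by (auto simp: linear_on_def subset_iff)
  have "\<sigma> x = 0" if "x \<in> carrier ?V" "\<phi> x = 0" for x using sS \<phi>(3)[of x] that by simp
  \<comment> \<open>In coordinates, h is the map induced by \<open>\<sigma>\<close> on the quotient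
    of \<open>F' \<inter> R\<close>. Its image will contain M, which gives the bound n.\<close>
  then obtain h where h: "linear_on (coord_space n) K h" "\<And>x. x \<in> carrier ?V \<Longrightarrow> h (\<phi> x) = \<sigma> x"
    using linear_on_factor[OF H(4) is_vspace_coord_space vK lp lsV] by blast
  \<comment> \<open>Every element of K differs from one in the image of \<open>\<sigma>\<close> by
    an element of M, and these central corrections disappear in products.\<close>
  have "prods K (carrier K) (carrier K) \<subseteq> \<sigma> ` prods F (carrier F) (carrier F)"
  proof
    fix z assume "z \<in> prods K (carrier K) (carrier K)"
    then obtain k x y where z: "z = prd K k x y" and xy: "x \<in> carrier K" "y \<in> carrier K"
      by (auto simp: prods_def)
    have lift: "\<exists>a\<in>carrier F. x - \<sigma> a \<in> M" if "x \<in> carrier K" for x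
    proof -
      have "\<mu> x \<in> \<pi> ` carrier F" unfolding P(4) using linear_onD(1)[OF lm that] .
      then obtain a where a: "a \<in> carrier F" "\<mu> x = \<pi> a" by blast
      then have "x - \<sigma> a \<in> M" unfolding mu(3)
        using that cs[OF a(1)] \<sigma>(2)[OF a(1)] is_vspaceD(6)[OF vK] by (simp add: linear_on_diff[OF vK lm])
      then show ?thesis using a(1) by blast
    qed
    obtain a where a: "a \<in> carrier F" "x - \<sigma> a \<in> M" using lift[OF xy(1)] by blast
    obtain b where b: "b \<in> carrier F" "y - \<sigma> b \<in> M" using lift[OF xy(2)] by blast
    have "prd K k (x - \<sigma> a) y = 0" "prd K k (\<sigma> a) (y - \<sigma> b) = 0"
      using cen a b xy cs by blast+
    then have "z = \<sigma> (prd F k a b)"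
      using xy a(1) b(1) cs by (simp add: z hs bilinear_diff[OF vK triassociativeD(2)[OF K]])
    then show "z \<in> \<sigma> ` prods F (carrier F) (carrier F)" using prodsI[OF a(1) b(1)] by blast
  qed
  then have "derived K \<subseteq> span (\<sigma> ` prods F (carrier F) (carrier F))"
    unfolding derived_eq[OF vK] by (rule span_mono)
  also have "\<dots> = \<sigma> ` derived F" unfolding derived_eq[OF vF]
    using linear_on_span_image[OF vF vK ls prods_subset_carrier[OF P(1) order_refl order_refl]] by simp
  finally have dK: "derived K \<subseteq> \<sigma> ` derived F" .
  have dF: "derived F \<subseteq> carrier F" using subspace_ofD(2)[OF vF subspace_of_derived[OF P(1)]] .
  have "M \<subseteq> h ` carrier (coord_space n)"
  proof
    fix m assume m: "m \<in> M"
    then obtain x where x: "x \<in> derived F" "m = \<sigma> x" using Md dK by blast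
    have "\<pi> x = 0" using \<sigma>(2)[of x] dF x m mu(3) by auto
    then have xV: "x \<in> derived F \<inter> R" using x(1) dF P(5) by auto
    then have "\<phi> x \<in> carrier (coord_space n)" using \<phi>(2) by blast
    then show "m \<in> h ` carrier (coord_space n)" using h(2)[of x] xV x(2) by (intro image_eqI[of _ _ "\<phi> x"]) auto
  qed
  also have "h ` carrier (coord_space n) = span (h ` unit_vec ` {..<n})"
    using linear_on_span_image[OF is_vspace_coord_space vK h(1), of "unit_vec ` {..<n}"]
      coord_space_basis(1)[of n, where 'f = 'f] by (simp only: basis_of_def)
  finally have "A \<subseteq> span (h ` unit_vec ` {..<n})" using A(1) by (auto simp: basis_of_def)
  then have "card A \<le> card (h ` unit_vec ` {..<n})"
    using independent_span_bound[of "h ` unit_vec ` {..<n}" A] A(1) by (simp add: basis_of_def)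
  also have "\<dots> \<le> n" using card_image_le[of "unit_vec ` {..<n}" h] coord_space_basis(2)[of n, where 'f = 'f]
    by simp
  finally show ?thesis using that A C by blast
qed

text \<open>The cover is \<open>F / T\<close> with \<open>T\<close> the kernel of \<open>x \<mapsto> (\<phi> x, \<pi> x)\<close>; within \<open>R\<close> it is a complement of
  \<open>F' \<inter> R\<close> modulo \<open>F \<lozenge> R + R \<lozenge> F\<close>.\<close>

lemma cover_exists:
  fixes F :: "('f::field, 'b::ab_group_add) trialg" and L :: "('f, 'l::ab_group_add) trialg"
  assumes L: "triassociative L" and FR: "free_presentation F R \<pi> L"
    and n: "hopf_quotient F R \<cong>\<^sub>v coord_space n"
  obtains K :: "('f, 'l expr \<Rightarrow> 'f) trialg" and M
  where "defining_pair L K M" "restr_space K M \<cong>\<^sub>v coord_space n"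
proof -
  note P = free_presentationD[OF FR] and H = hopf_subspaces[OF FR]
  note vF = H(1) and vL = triassociativeD(1)[OF L]
  note lp = tri_homD(1)[OF P(3)] and hp = tri_homD(2)[OF P(3)] and cp = tri_homD(3)[OF P(3)]
  note zL = is_vspaceD(4)[OF vL]
  interpret L: vector_space "scl L" using is_vspaceD(1)[OF vL] .
  have RF: "R \<subseteq> carrier F" using subspace_ofD(2)[OF vF H(2)] .
  obtain \<phi> where \<phi>: "linear_on F (coord_space n) \<phi>" "\<phi> ` (derived F \<inter> R) = carrier (coord_space n)"
    "\<And>x. x \<in> derived F \<inter> R \<Longrightarrow> \<phi> x = 0 \<longleftrightarrow> x \<in> mixed F R"
    using hopf_functional[OF FR n] by blast
  obtain e :: "(nat \<Rightarrow> 'f) \<Rightarrow> 'l \<Rightarrow> 'l expr \<Rightarrow> 'f" where e: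
    "\<And>a b x y. x \<in> carrier L \<Longrightarrow> y \<in> carrier L \<Longrightarrow> e (a + b) (x + y) = e a x + e b y"
    "\<And>c a x. x \<in> carrier L \<Longrightarrow> e (\<lambda>i. c * a i) (scl L c x) = (\<lambda>t. c * e a x t)"
    "\<And>a x. x \<in> carrier L \<Longrightarrow> e a x = 0 \<Longrightarrow> a = 0 \<and> x = 0"
    using expr_embedding[OF vL] by blast
  have e0: "e 0 0 = 0" using e(1)[OF zL zL, of 0 0] by simp
  \<comment> \<open>By injectivity of e the kernel is that of the pair, while the values lie in the
    type in which maximality is tested.\<close>
  define q where "q x = e (\<phi> x) (\<pi> x)" for x
  have lq: "linear_on F fun_space q"
  proof (rule linear_onI)
    fix x y assume "x \<in> carrier F" "y \<in> carrier F"
    then show "q (x + y) = q x + q y"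
      using e(1)[OF cp cp, of x y "\<phi> x" "\<phi> y"] by (simp add: q_def linear_onD(2)[OF \<phi>(1)] linear_onD(2)[OF lp])
  next
    fix c x assume "x \<in> carrier F"
    then show "q (scl F c x) = scl fun_space c (q x)"
      using e(2)[OF cp, of x c "\<phi> x"] by (simp add: q_def linear_onD(3)[OF \<phi>(1)] linear_onD(3)[OF lp])
  qed simp
  \<comment> \<open>Products with a factor in R lie in S, where both \<open>\<phi>\<close> and
    \<open>\<pi>\<close> vanish. This makes the kernel of q an ideal and later makes M, the image of
    R, central.\<close>
  have qR: "q (prd F k a x) = 0 \<and> q (prd F k x a) = 0" if "a \<in> carrier F" "x \<in> R" for k a x
  proof -
    have m: "prd F k a x \<in> mixed F R" "prd F k x a \<in> mixed F R" using prd_mixed[OF vF that] .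
    then have d: "prd F k a x \<in> derived F \<inter> R" "prd F k x a \<in> derived F \<inter> R"
      using mixed_subset[OF P(1,2)] by blast+
    then have "\<phi> (prd F k a x) = 0" "\<phi> (prd F k x a) = 0" using m \<phi>(3) by blast+
    moreover have "\<pi> (prd F k a x) = 0" "\<pi> (prd F k x a) = 0" using d P(5) by auto
    ultimately show ?thesis by (simp add: q_def e0)
  qed
  have kR: "\<pi> x = 0" if "x \<in> carrier F" "q x = 0" for x using e(3)[OF cp[OF that(1)], of "\<phi> x"] that(2) by (simp add: q_def)
  have ker: "q (prd F k a x) = 0 \<and> q (prd F k x a) = 0"
    if "a \<in> carrier F" "x \<in> carrier F" "q x = 0" for k a x
    using qR[OF that(1), of x k] kR[OF that(2,3)] that(2) P(5) by blast
  obtain K where K: "triassociative K" "carrier K = q ` carrier F" "scl K = scl fun_space" "tri_hom F K q"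
    using push_forward_algebra[OF P(1) is_vspace_fun_space lq] ker by metis
  note vK = triassociativeD(1)[OF K(1)] and hq = tri_homD(2)[OF K(4)] and lqK = tri_homD(1)[OF K(4)]
  obtain \<mu> where mu: "linear_on K L \<mu>" "\<And>x. x \<in> carrier F \<Longrightarrow> \<mu> (q x) = \<pi> x"
    using linear_on_factor[OF vF vK vL lqK lp kR] by blast
  define M where "M = {u \<in> carrier K. \<mu> u = 0}"
  have M: "M = q ` R" unfolding M_def K(2) P(5) using mu(2) by auto
  have "\<mu> (prd K k u v) = prd L k (\<mu> u) (\<mu> v)" if uv: "u \<in> carrier K" "v \<in> carrier K" for k u v
  proof -
    obtain x where x: "x \<in> carrier F" "u = q x" using uv(1) unfolding K(2) by blast
    obtain y where y: "y \<in> carrier F" "v = q y" using uv(2) unfolding K(2) by blast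
    have "\<mu> (prd K k u v) = \<mu> (q (prd F k x y))" using hq[OF x(1) y(1)] x y by simp
    also have "\<dots> = prd L k (\<mu> u) (\<mu> v)"
      using x y triassociativeD(3)[OF P(1) x(1) y(1)] by (simp add: mu(2) hp)
    finally show ?thesis .
  qed
  then have hm: "tri_hom K L \<mu>" unfolding tri_hom_iff using mu(1) by blast
  have om: "\<mu> ` carrier K = carrier L" unfolding K(2) image_image P(4)[symmetric]
    by (rule image_cong) (simp_all add: mu(2))
  have prd0: "prd K k u m = 0 \<and> prd K k m u = 0" if u: "u \<in> carrier K" and m: "m \<in> M" for k u m
  proof -
    obtain x where x: "x \<in> carrier F" "u = q x" using u unfolding K(2) by blast
    obtain r where r: "r \<in> R" "m = q r" using m unfolding M by blast
    have "r \<in> carrier F" using r(1) RF by blast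
    then show ?thesis using qR[OF x(1) r(1), of k] hq[of x r k] hq[of r x k] x r by simp
  qed
  have sM: "subspace_of K M" unfolding M_def by (rule linear_on_kernel_subspace[OF vK vL mu(1)])
  have iM: "tri_ideal K M" unfolding tri_ideal_iff using sM prd0 subspace_ofD(4)[OF vK sM] by simp
  have cM: "M \<subseteq> center K"
    unfolding center_iff[abs_def] subset_iff using prd0 M_def by (auto simp: center_iff)
  \<comment> \<open>On R the value of q depends only on \<open>\<phi>\<close>, which already attains
    all its values on \<open>F' \<inter> R\<close>. Hence R and \<open>F' \<inter> R\<close> have
    the same image M, which therefore lies in \<open>derived K\<close> and is a copy of
    \<open>coord_space n\<close>.\<close>
  have MV: "\<exists>x\<in>derived F \<inter> R. \<phi> x = \<phi> r" if "r \<in> R" for r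
  proof -
    have "\<phi> r \<in> \<phi> ` (derived F \<inter> R)" unfolding \<phi>(2) using linear_onD(1)[OF \<phi>(1)] that RF by blast
    then show ?thesis by force
  qed
  have q_R: "q x = e (\<phi> x) 0" if "x \<in> R" for x using that P(5) by (simp add: q_def)
  have qd: "q ` derived F \<subseteq> derived K"
  proof -
    have "q ` prods F (carrier F) (carrier F) \<subseteq> prods K (carrier K) (carrier K)"
      using hq K(2) by (auto simp: prods_def) blast
    then show ?thesis unfolding derived_eq[OF vF] derived_eq[OF vK]
      linear_on_span_image[OF vF vK lqK prods_subset_carrier[OF P(1) order_refl order_refl]]
      by (rule module.span_mono[OF is_vspaceD(2)[OF vK]])
  qed
  have dM: "M \<subseteq> derived K"
  proof
    fix m assume "m \<in> M"
    then obtain r where r: "r \<in> R" "m = q r" unfolding M by blast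
    obtain x where x: "x \<in> derived F \<inter> R" "\<phi> x = \<phi> r" using MV[OF r(1)] by blast
    then have "m = q x" using q_R r by simp
    then show "m \<in> derived K" using x(1) qd by blast
  qed
  have "L \<cong>\<^sub>t quot_alg K M" unfolding iso_quot_alg_iff[OF L K(1) iM] using hm om M_def by blast
  then have pair: "defining_pair L K M" unfolding defining_pair_def using K(1) iM cM dM by blast
  let ?i = "\<lambda>v. e v 0"
  have Mi: "M = ?i ` carrier (coord_space n)"
  proof (intro equalityI subsetI)
    fix m assume "m \<in> M"
    then obtain r where r: "r \<in> R" "m = q r" unfolding M by blast
    then show "m \<in> ?i ` carrier (coord_space n)" using q_R linear_onD(1)[OF \<phi>(1)] RF by blast
  next
    fix m assume "m \<in> ?i ` carrier (coord_space n)"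
    then obtain x where "x \<in> derived F \<inter> R" "m = e (\<phi> x) 0" unfolding \<phi>(2)[symmetric] by blast
    then show "m \<in> M" unfolding M using q_R by auto
  qed
  have li: "linear_on (coord_space n) (restr_space K M) ?i"
  proof (rule linear_onI)
    show "e v 0 \<in> carrier (restr_space K M)" if "v \<in> carrier (coord_space n)" for v
      unfolding restr_space_simps Mi using that by blast
    show "e (u + v) 0 = e u 0 + e v 0" for u v using e(1)[OF zL zL, of u v] by simp
    show "e (scl (coord_space n) c v) 0 = scl (restr_space K M) c (e v 0)" for c v
      using e(2)[OF zL, of c v] K(3) by simp
  qed
  have "inj_on ?i (carrier (coord_space n))" unfolding inj_on_linear_iff[OF is_vspace_coord_space li]
    using e(3)[OF zL] by blast
  then have "coord_space n \<cong>\<^sub>v restr_space K M" unfolding vspace_iso_def bij_betw_def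
    using li Mi by (intro exI[of _ ?i]) simp
  then have "restr_space K M \<cong>\<^sub>v coord_space n" using is_vspace_iso_sym[OF is_vspace_coord_space] by blast
  then show ?thesis using that pair by blast
qed

theorem theorem4p6:
  fixes L :: "('f::field, 'l::ab_group_add) trialg"
    and F :: "('f, 'b::ab_group_add) trialg"
    and R :: "'b set" and \<pi> :: "'b \<Rightarrow> 'l"
  assumes "triassociative L"
    and "free_presentation F R \<pi> L"
  shows "(finite_dimensional (hopf_quotient F R) \<longrightarrow>
            cohomology2 L ground_field \<cong>\<^sub>v hopf_quotient F R) \<and>
         (finite_dimensional L \<longrightarrow>
            finite_dimensional (hopf_quotient F R) \<and>
            (\<exists>N :: ('f, 'l expr \<Rightarrow> 'f) vspace. is_multiplier L N) \<and>
            (\<forall>N :: ('f, 'k::ab_group_add) vspace.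
               is_multiplier L N \<longrightarrow> N \<cong>\<^sub>v cohomology2 L ground_field))"
proof (intro conjI impI)
  note L = assms(1) and FR = assms(2)
  note H = hopf_subspaces[OF FR]
  note C = cohomology2_iso_coord_space[OF L FR]
  assume "finite_dimensional (hopf_quotient F R)"
  then obtain n where n: "hopf_quotient F R \<cong>\<^sub>v coord_space n" unfolding finite_dimensional_def by blast
  have "coord_space n \<cong>\<^sub>v hopf_quotient F R"
    unfolding hopf_quotient_eq by (rule quot_space_iso_sym[OF H(4,5) n[unfolded hopf_quotient_eq]])
  then show "cohomology2 L ground_field \<cong>\<^sub>v hopf_quotient F R" using C(1)[OF n] vspace_iso_trans by blast
next
  note L = assms(1) and FR = assms(2)
  note vL = triassociativeD(1)[OF L]
  note C = cohomology2_iso_coord_space[OF L FR]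
  assume "finite_dimensional L"
  then obtain B where B: "basis_of L B" "finite B"
    unfolding finite_dimensional_def iso_coord_space_iff_basis[OF vL] by blast
  obtain n where n: "hopf_quotient F R \<cong>\<^sub>v coord_space n" using hopf_quotient_finite[OF L FR B] by blast
  then show "finite_dimensional (hopf_quotient F R)" unfolding finite_dimensional_def by blast
  note dim = defining_pair_dimension[OF L FR n B]
  obtain K :: "('f, 'l expr \<Rightarrow> 'f) trialg" and M
    where KM: "defining_pair L K M" "restr_space K M \<cong>\<^sub>v coord_space n"
    using cover_exists[OF L FR n] by blast
  obtain A D where A: "basis_of (restr_space K M) A" "finite A" "card A \<le> n"
    and D: "basis_of K D" "finite D" "card D = card A + card B"
    by (rule dim[OF KM(1)])
  have K: "triassociative K" "subspace_of K M" using KM(1) by (auto simp: defining_pair_def tri_ideal_iff)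
  note vK = triassociativeD(1)[OF K(1)] and vM = subspace_ofD(1)[OF triassociativeD(1)[OF K(1)] K(2)]
  obtain A' where A': "basis_of (restr_space K M) A'" "card A' = n"
    using KM(2) unfolding iso_coord_space_iff_basis[OF vM] by blast
  have cA: "card A = n" using basis_of_card(2)[OF vM A(1) A'(1) A(2)] A'(2) by simp
  have "dim_le K2 K" if K2: "defining_pair L K2 M2" for K2 :: "('f, 'l expr \<Rightarrow> 'f) trialg" and M2
  proof -
    obtain A2 D2 where "basis_of (restr_space K2 M2) A2" "finite A2" "card A2 \<le> n"
      and "basis_of K2 D2" "finite D2" "card D2 = card A2 + card B"
      by (rule dim[OF K2])
    \<comment> \<open>The dimension of K2 is that of M2 plus that of L, hence at most n plus that of
      L, which is the dimension of K.\<close>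
    then have "basis_of K2 D2 \<and> basis_of K D \<and> D2 \<lesssim> D"
      using D cA by (simp add: lepoll_iff_card_le)
    then show ?thesis unfolding dim_le_def by blast
  qed
  then have "maximal_defining_pair L K M" unfolding maximal_defining_pair_def using KM(1) by blast
  then show "\<exists>N :: ('f, 'l expr \<Rightarrow> 'f) vspace. is_multiplier L N" unfolding is_multiplier_def by blast
  show "\<forall>N :: ('f, 'k::ab_group_add) vspace. is_multiplier L N \<longrightarrow> N \<cong>\<^sub>v cohomology2 L ground_field"
  proof (intro allI impI)
    fix N :: "('f, 'k) vspace"
    assume "is_multiplier L N"
    then obtain K1 :: "('f, 'k) trialg" and M1 where N: "N = restr_space K1 M1"
      and m1: "maximal_defining_pair L K1 M1" unfolding is_multiplier_def by blast
    \<comment> \<open>K is an admissible competitor of K1 because its type is the one over which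
      maximality quantifies.\<close>
    have p1: "defining_pair L K1 M1" and le: "dim_le K K1"
      using m1 KM(1) unfolding maximal_defining_pair_def by blast+
    have K1: "triassociative K1" "subspace_of K1 M1" using p1 by (auto simp: defining_pair_def tri_ideal_iff)
    note vK1 = triassociativeD(1)[OF K1(1)]
    note vM1 = subspace_ofD(1)[OF vK1 K1(2)]
    obtain A1 D1 where A1: "basis_of (restr_space K1 M1) A1" "finite A1" "card A1 \<le> n"
      and D1: "basis_of K1 D1" "finite D1" "card D1 = card A1 + card B"
      by (rule dim[OF p1])
    obtain E E1 where E: "basis_of K E" "basis_of K1 E1" "E \<lesssim> E1" using le unfolding dim_le_def by blast
    have "finite E" "card E = card D" using basis_of_card[OF vK D(1) E(1) D(2)] .
    moreover have "finite E1" "card E1 = card D1" using basis_of_card[OF vK1 D1(1) E(2) D1(2)] .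
    ultimately have "card D \<le> card D1" using E(3) by (simp add: lepoll_iff_card_le)
    \<comment> \<open>Cancelling the dimension of L in the comparison of K with K1 gives that n is
      at most \<open>card A1\<close>; the reverse bound holds for every defining pair.\<close>
    then have "card A1 = n" using A1(3) D(3) D1(3) cA by simp
    then have "N \<cong>\<^sub>v coord_space n" unfolding N using coordinates_iso[OF vM1 A1(1,2)] by simp
    moreover have "coord_space n \<cong>\<^sub>v cohomology2 L ground_field" unfolding cohomology2_eq
      by (rule quot_space_iso_sym[OF is_vspace_cocycle_space C(2)[OF n] C(1)[OF n, unfolded cohomology2_eq]])
    ultimately show "N \<cong>\<^sub>v cohomology2 L ground_field" by (rule vspace_iso_trans)
  qed
qed

end
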